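(* Let $1\le N_0\le N$ and let $b(s)$ be the Brownian motion on the spider graph $Sp_N$ with Kirchhoff gluing at the origin, started at $0$. For $t>0$ let $\tau_{N,N_0}(t)=\sum_{i=1}^{N_0}\int_0^t\mathbb I_{l_i}(b(s))\,ds$ be the time spent by $b$ on the first $N_0$ legs $l_1,\dots,l_{N_0}$ up to time $t$, and let $\theta_{N,N_0}=\tau_{N,N_0}(t)/t$ (whose law does not depend on $t$). Then the moments $m_n=E_0\theta_{N,N_0}^n$ have generating function $$\phi_{\tau_{N,N_0}}(z)=\sum_{n=0}^\infty(-1)^nm_nz^n=\frac{1}{\sqrt{1+z}}\cdot\frac{N_0+(N-N_0)\sqrt{1+z}}{(N-N_0)+N_0\sqrt{1+z}},\qquad |z|<1.$$
   Context: The spider graph $Sp_N$ consists of $N$ half-lines (legs) $l_1,\dots,l_N$, each a copy of $[0,\infty)$ with coordinate $x_i\ge0$, glued at their common endpoint $0$. The Brownian motion $b(s)$ on $Sp_N$ is the continuous strong Markov process with generator $\frac12\frac{d^2}{dx_i^2}$ on each leg, acting on functions continuous on $Sp_N$, twice differentiable on each leg, and satisfying Kirchhoff's condition $\sum_{i=1}^N f_i'(0)=0$. Equivalently, away from $0$ it is a standard one-dimensional Brownian motion along the leg and from $0$ it enters each leg with equal probability $1/N$. $\mathbb I_{l_i}$ is the indicator of leg $l_i$. (For $N=2$, $N_0=1$ this is Lévy's arcsine law, with generating function $1/\sqrt{1+z}$.) *)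

theory Defs
  imports "HOL-Probability.Probability"
begin

text \<open>Points of the spider graph Sp_N are encoded as pairs (i, x) :: nat \<times> real.
  The common origin is the single point (0, 0); a point at distance x > 0 from the
  origin on leg l_i (1 \<le> i \<le> N) is (i, x).\<close>

definition spider_origin :: "nat \<times> real" where
  "spider_origin = (0, 0)"

definition spider_pts :: "nat \<Rightarrow> (nat \<times> real) set" where
  "spider_pts N = {spider_origin} \<union> {(i, x). 1 \<le> i \<and> i \<le> N \<and> x > 0}"

definition leg_pt :: "nat \<Rightarrow> real \<Rightarrow> nat \<times> real" where
  "leg_pt i x = (if x = 0 then spider_origin else (i, x))"

definition spider_dist :: "nat \<times> real \<Rightarrow> nat \<times> real \<Rightarrow> real" where
  "spider_dist p q = (if fst p = fst q then \<bar>snd p - snd q\<bar> else snd p + snd q)"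

text \<open>Measurable structure on the encoding (its trace on spider_pts is the Borel
  sigma-algebra of the spider).\<close>
definition spider_space :: "(nat \<times> real) measure" where
  "spider_space = count_space UNIV \<Otimes>\<^sub>M borel"

definition continuous_spider_path :: "(real \<Rightarrow> nat \<times> real) \<Rightarrow> bool" where
  "continuous_spider_path p \<longleftrightarrow>
     (\<forall>s\<ge>0. \<forall>e>0. \<exists>d>0. \<forall>s'\<ge>0. \<bar>s' - s\<bar> < d \<longrightarrow> spider_dist (p s') (p s) < e)"

definition C2c_half_line :: "(real \<Rightarrow> real) \<Rightarrow> (real \<Rightarrow> real) \<Rightarrow> (real \<Rightarrow> real) \<Rightarrow> bool" where
  "C2c_half_line g g1 g2 \<longleftrightarrow>
     (\<forall>x\<ge>0. (g has_real_derivative g1 x) (at x within {0..}) \<and>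
             (g1 has_real_derivative g2 x) (at x within {0..})) \<and>
     continuous_on {0..} g2 \<and> (\<exists>R. \<forall>x\<ge>R. g x = 0)"

text \<open>Domain of the generator: f continuous on Sp_N (automatic from the encoding via
  leg_pt), C^2 on every leg, second derivative continuous through the origin,
  and Kirchhoff's condition \<Sum> f_i'(0) = 0.  d1 i, d2 i are the derivatives along leg i.\<close>
definition kirchhoff_dom ::
  "nat \<Rightarrow> (nat \<times> real \<Rightarrow> real) \<Rightarrow> (nat \<Rightarrow> real \<Rightarrow> real) \<Rightarrow> (nat \<Rightarrow> real \<Rightarrow> real) \<Rightarrow> bool" where
  "kirchhoff_dom N f d1 d2 \<longleftrightarrow>
     (\<forall>i\<in>{1..N}. C2c_half_line (\<lambda>x. f (leg_pt i x)) (d1 i) (d2 i)) \<and>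
     (\<forall>i\<in>{1..N}. \<forall>j\<in>{1..N}. d2 i 0 = d2 j 0) \<and>
     (\<Sum>i=1..N. d1 i 0) = 0"

definition spider_gen :: "(nat \<Rightarrow> real \<Rightarrow> real) \<Rightarrow> nat \<times> real \<Rightarrow> real" where
  "spider_gen d2 p = (if fst p = 0 then d2 1 0 / 2 else d2 (fst p) (snd p) / 2)"

definition nat_filtration :: "'w measure \<Rightarrow> (real \<Rightarrow> 'w \<Rightarrow> nat \<times> real) \<Rightarrow> real \<Rightarrow> 'w set set" where
  "nat_filtration M b s = sigma_sets (space M)
     {b u -` B \<inter> space M | u B. 0 \<le> u \<and> u \<le> s \<and> B \<in> sets spider_space}"

definition is_martingale :: "'w measure \<Rightarrow> (real \<Rightarrow> 'w \<Rightarrow> nat \<times> real) \<Rightarrow> (real \<Rightarrow> 'w \<Rightarrow> real) \<Rightarrow> bool" where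
  "is_martingale M b X \<longleftrightarrow>
     (\<forall>t\<ge>0. integrable M (X t)) \<and>
     (\<forall>s t A. 0 \<le> s \<longrightarrow> s \<le> t \<longrightarrow> A \<in> nat_filtration M b s \<longrightarrow>
        (\<integral>\<omega>. indicator A \<omega> * (X t \<omega> - X s \<omega>) \<partial>M) = 0)"

text \<open>b is a Brownian motion on Sp_N (Kirchhoff gluing): a process with continuous paths
  in Sp_N solving the martingale problem for the generator (1/2) d^2/dx_i^2 with
  Kirchhoff's condition.\<close>
definition spider_BM :: "nat \<Rightarrow> 'w measure \<Rightarrow> (real \<Rightarrow> 'w \<Rightarrow> nat \<times> real) \<Rightarrow> bool" where
  "spider_BM N M b \<longleftrightarrow>
     prob_space M \<and>
     (\<forall>s\<ge>0. b s \<in> measurable M spider_space) \<and>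
     (\<forall>\<omega>\<in>space M. \<forall>s\<ge>0. b s \<omega> \<in> spider_pts N) \<and>
     (\<forall>\<omega>\<in>space M. continuous_spider_path (\<lambda>s. b s \<omega>)) \<and>
     (\<forall>f d1 d2. kirchhoff_dom N f d1 d2 \<longrightarrow>
        is_martingale M b
          (\<lambda>t \<omega>. f (b t \<omega>) - f (b 0 \<omega>) - integral {0..t} (\<lambda>s. spider_gen d2 (b s \<omega>))))"

definition occ_time :: "nat \<Rightarrow> (real \<Rightarrow> 'w \<Rightarrow> nat \<times> real) \<Rightarrow> real \<Rightarrow> 'w \<Rightarrow> real" where
  "occ_time N0 b t \<omega> =
     (\<Sum>i=1..N0. integral {0..t} (\<lambda>s. if fst (b s \<omega>) = i then 1 else 0))"

end

theory Submission
  imports Defs "HOL-Complex_Analysis.Complex_Analysis" "HOL-Real_Asymp.Real_Asymp"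
begin

text \<open>
  Let \<open>A\<close> be the union of the first \<open>N0\<close> legs without the origin. The bounded solution of
  \<open>u''/2 = (l + \<beta> 1\<^sub>A) u - 1\<close> on the legs with Kirchhoff's condition is explicit, and by the
  Feynman-Kac formula its value at the origin is
  \<open>\<integral> exp (- l s) E exp (- \<beta> \<tau>(s)) ds\<close> over \<open>s \<ge> 0\<close>. This value equals \<open>\<phi>(\<beta>/l) / l\<close>, where \<open>\<phi>\<close> is the
  claimed generating function. Comparing the coefficients of \<open>\<beta>\<^sup>n\<close> shows that the Laplace transforms
  of \<open>E \<tau>(s)\<^sup>n\<close> and of \<open>(-1)\<^sup>n a\<^sub>n s\<^sup>n\<close> agree, where \<open>a\<^sub>n\<close> are the Taylor coefficients of \<open>\<phi>\<close>; by
  uniqueness of the Laplace transform, \<open>E \<tau>(s)\<^sup>n = (-1)\<^sup>n a\<^sub>n s\<^sup>n\<close>.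

  Only a martingale problem is given, so Feynman-Kac is first proved for continuous potentials and
  compactly supported functions in the domain of the generator, from the pathwise identity
  \<open>Z\<^sub>t f(b\<^sub>t) - f(b\<^sub>0) = X\<^sub>t + \<integral> Z\<^sub>r (L f - v f)(b\<^sub>r) dr - \<integral> v(b\<^sub>r) Z\<^sub>r (X\<^sub>t - X\<^sub>r) dr\<close> with
  \<open>Z\<^sub>t = exp (- \<integral> v(b\<^sub>r) dr)\<close> and the martingale \<open>X\<close> of \<open>f\<close>. Since \<open>u''\<close> jumps at the origin and
  \<open>u\<close> is not compactly supported, \<open>u\<close> is approximated by such functions.
\<close>

subsection \<open>Time integrals of continuous processes\<close>

text \<open>Rounding time down to multiples of \<open>1 / Suc n\<close> leaves countably many time
  values, so the rounded process is jointly measurable. Path continuity passes this to the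
  limit.\<close>

lemma borel_measurable_pair_continuous:
  fixes X :: "real \<Rightarrow> 'w \<Rightarrow> real"
  assumes meas: "\<And>r. X r \<in> borel_measurable F"
    and cont: "\<And>\<omega>. \<omega> \<in> space F \<Longrightarrow> continuous_on UNIV (\<lambda>r. X r \<omega>)"
  shows "(\<lambda>p. X (fst p) (snd p)) \<in> borel_measurable (borel \<Otimes>\<^sub>M F)"
proof (rule borel_measurable_LIMSEQ_real)
  fix n :: nat
  have [measurable]: "X r \<in> borel_measurable F" for r
    by (rule meas)
  show "(\<lambda>p. X (real_of_int \<lfloor>real (Suc n) * fst p\<rfloor> / real (Suc n)) (snd p))
      \<in> borel_measurable (borel \<Otimes>\<^sub>M F)"
    by (rule measurable_compose_countable
        [where f = "\<lambda>i p. X (real_of_int i / real (Suc n)) (snd p)"]) measurable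
next
  fix p assume "p \<in> space (borel \<Otimes>\<^sub>M F :: (real \<times> 'w) measure)"
  then have "snd p \<in> space F"
    by (auto simp: space_pair_measure)
  moreover have "(\<lambda>n. real_of_int \<lfloor>real (Suc n) * fst p\<rfloor> / real (Suc n)) \<longlonglongrightarrow> fst p"
  proof (rule tendsto_sandwich[where f = "\<lambda>n. fst p - 1 / real (Suc n)" and h = "\<lambda>n. fst p"])
    have "real (Suc n) * (fst p - 1 / real (Suc n)) \<le> \<lfloor>real (Suc n) * fst p\<rfloor>" for n
      by (simp add: right_diff_distrib del: of_nat_Suc)
    then show "\<forall>\<^sub>F n in sequentially. fst p - 1 / real (Suc n)
        \<le> real_of_int \<lfloor>real (Suc n) * fst p\<rfloor> / real (Suc n)"
      by (intro always_eventually allI) (simp add: field_simps)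
    have "\<lfloor>real (Suc n) * fst p\<rfloor> \<le> real (Suc n) * fst p" for n
      by linarith
    then show "\<forall>\<^sub>F n in sequentially.
        real_of_int \<lfloor>real (Suc n) * fst p\<rfloor> / real (Suc n) \<le> fst p"
      by (intro always_eventually allI) (simp add: field_simps)
    have "(\<lambda>n. fst p - 1 / real (Suc n)) \<longlonglongrightarrow> fst p - 0"
      by (intro tendsto_diff tendsto_const lim_1_over_n[THEN LIMSEQ_Suc])
    then show "(\<lambda>n. fst p - 1 / real (Suc n)) \<longlonglongrightarrow> fst p"
      by simp
  qed simp
  ultimately show "(\<lambda>n. X (real_of_int \<lfloor>real (Suc n) * fst p\<rfloor> / real (Suc n)) (snd p))
      \<longlonglongrightarrow> X (fst p) (snd p)"
    using continuous_on_tendsto_compose[OF cont] by auto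
qed

text \<open>Joint measurability was shown for paths continuous on the whole line. Clamping time to
  \<open>{0..t}\<close> supplies such paths, and the indicator of \<open>{0..t}\<close> hides the
  extension in the integrals below.\<close>

lemma continuous_on_clamp:
  fixes g :: "real \<Rightarrow> real"
  assumes "continuous_on {0..t} g" "0 \<le> t"
  shows "continuous_on UNIV (\<lambda>r. g (max 0 (min t r)))"
  by (rule continuous_on_compose2[OF assms(1)]) (use assms(2) in \<open>auto intro!: continuous_intros\<close>)

lemma integral_eq_clamped_lborel:
  fixes g :: "real \<Rightarrow> real"
  assumes "continuous_on {0..t} g" "0 \<le> t"
  shows "integral {0..t} g = (LINT r|lborel. indicator {0..t} r * g (max 0 (min t r)))"
proof -
  have "integral {0..t} g = (LINT r:{0..t}|lborel. g r)"
    using set_borel_integral_eq_integral(2)[OF borel_integrable_atLeastAtMost'[OF assms(1)]] by simp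
  also have "\<dots> = (LINT r|lborel. indicator {0..t} r * g (max 0 (min t r)))"
    unfolding set_lebesgue_integral_def
    by (intro Bochner_Integration.integral_cong) (auto simp: indicator_def max_def min_def)
  finally show ?thesis .
qed

lemma borel_measurable_pair_clamped:
  fixes X :: "real \<Rightarrow> 'w \<Rightarrow> real"
  assumes "0 \<le> t" "\<And>r. r \<in> {0..t} \<Longrightarrow> X r \<in> borel_measurable F"
    and "\<And>\<omega>. \<omega> \<in> space F \<Longrightarrow> continuous_on {0..t} (\<lambda>r. X r \<omega>)"
  shows "(\<lambda>p. X (max 0 (min t (fst p))) (snd p)) \<in> borel_measurable (borel \<Otimes>\<^sub>M F)"
  using borel_measurable_pair_continuous[of "\<lambda>r. X (max 0 (min t r))" F]
    continuous_on_clamp[OF assms(3,1)] assms(1,2) by auto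

lemma borel_measurable_time_integral:
  fixes X :: "real \<Rightarrow> 'w \<Rightarrow> real"
  assumes "0 \<le> t" "\<And>r. r \<in> {0..t} \<Longrightarrow> X r \<in> borel_measurable F"
    and "\<And>\<omega>. \<omega> \<in> space F \<Longrightarrow> continuous_on {0..t} (\<lambda>r. X r \<omega>)"
  shows "(\<lambda>\<omega>. integral {0..t} (\<lambda>r. X r \<omega>)) \<in> borel_measurable F"
proof -
  have m: "(\<lambda>p. X (max 0 (min t (fst p))) (snd p)) \<in> borel_measurable (borel \<Otimes>\<^sub>M F)"
    by (rule borel_measurable_pair_clamped[OF assms])
  have "(\<lambda>(\<omega>, r). X (max 0 (min t r)) \<omega>) \<in> borel_measurable (F \<Otimes>\<^sub>M lborel)"
    using measurable_compose[OF _ m, of "\<lambda>(\<omega>, r). (r, \<omega>)" "F \<Otimes>\<^sub>M lborel"]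
    by (simp add: case_prod_beta')
  then have "(\<lambda>(\<omega>, r). indicator {0..t} r * X (max 0 (min t r)) \<omega>)
      \<in> borel_measurable (F \<Otimes>\<^sub>M lborel)"
    by (simp add: case_prod_beta')
  then have "(\<lambda>\<omega>. LINT r|lborel. indicator {0..t} r * X (max 0 (min t r)) \<omega>) \<in> borel_measurable F"
    by (rule lborel.borel_measurable_lebesgue_integral)
  then show ?thesis
    by (subst measurable_cong) (auto intro: integral_eq_clamped_lborel[OF assms(3,1)])
qed

text \<open>The bound also covers a non-integrable \<open>f\<close>: its expectation is 0 by
  convention, and \<open>B\<close> is nonnegative because the space is nonempty.\<close>

lemma (in prob_space) expectation_abs_bound:
  fixes f :: "'a \<Rightarrow> real"
  assumes "\<And>\<omega>. \<omega> \<in> space M \<Longrightarrow> \<bar>f \<omega>\<bar> \<le> B"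
  shows "\<bar>expectation f\<bar> \<le> B"
proof (cases "integrable M f")
  case True
  have "\<bar>expectation f\<bar> \<le> expectation (\<lambda>\<omega>. \<bar>f \<omega>\<bar>)"
    using integral_norm_bound[of M f] by simp
  also have "\<dots> \<le> expectation (\<lambda>_. B)"
    using True assms by (intro integral_mono) auto
  finally show ?thesis
    by (simp add: prob_space)
next
  case False
  obtain \<omega> where "\<omega> \<in> space M"
    using not_empty by blast
  then have "0 \<le> B"
    using assms[of \<omega>] by linarith
  then show ?thesis
    by (simp add: not_integrable_integral_eq[OF False])
qed

text \<open>Fubini: the integrand is bounded and supported on
  \<open>space M \<times> {0..t}\<close>, which has finite product measure.\<close>

lemma (in prob_space) expectation_time_integral:
  fixes X :: "real \<Rightarrow> 'a \<Rightarrow> real"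
  assumes t: "0 \<le> t" and meas: "\<And>r. r \<in> {0..t} \<Longrightarrow> X r \<in> borel_measurable M"
    and cont: "\<And>\<omega>. \<omega> \<in> space M \<Longrightarrow> continuous_on {0..t} (\<lambda>r. X r \<omega>)"
    and bound: "\<And>r \<omega>. r \<in> {0..t} \<Longrightarrow> \<omega> \<in> space M \<Longrightarrow> \<bar>X r \<omega>\<bar> \<le> B"
  shows "expectation (\<lambda>\<omega>. integral {0..t} (\<lambda>r. X r \<omega>)) = (LINT r:{0..t}|lborel. expectation (X r))"
proof -
  interpret P: pair_sigma_finite M lborel ..
  have m: "(\<lambda>p. X (max 0 (min t (fst p))) (snd p)) \<in> borel_measurable (borel \<Otimes>\<^sub>M M)"
    by (rule borel_measurable_pair_clamped[OF t meas cont])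
  define G where "G = (\<lambda>\<omega> r. indicator {0..t} r * X (max 0 (min t r)) \<omega>)"
  have "(\<lambda>(\<omega>, r). X (max 0 (min t r)) \<omega>) \<in> borel_measurable (M \<Otimes>\<^sub>M lborel)"
    using measurable_compose[OF _ m, of "\<lambda>(\<omega>, r). (r, \<omega>)" "M \<Otimes>\<^sub>M lborel"]
    by (simp add: case_prod_beta')
  then have Gm[measurable]: "case_prod G \<in> borel_measurable (M \<Otimes>\<^sub>M lborel)"
    by (simp add: case_prod_beta' G_def)
  have bd: "AE p in M \<Otimes>\<^sub>M lborel. p \<in> space M \<times> {0..t} \<longrightarrow> norm (case_prod G p) \<le> B"
    using bound t by (intro AE_I2) (auto simp: G_def indicator_def)
  have em: "emeasure (M \<Otimes>\<^sub>M lborel) (space M \<times> {0..t}) < \<infinity>"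
    using t by (simp add: lborel.emeasure_pair_measure_Times emeasure_space_1)
  have int: "integrable (M \<Otimes>\<^sub>M lborel) (case_prod G)"
    by (rule integrableI_bounded_set[OF _ Gm em bd]) (auto simp: G_def space_pair_measure
        indicator_def intro!: AE_I2 split: if_splits)
  have "expectation (\<lambda>\<omega>. integral {0..t} (\<lambda>r. X r \<omega>)) = (\<integral>\<omega>. (\<integral>r. G \<omega> r \<partial>lborel) \<partial>M)"
    by (intro Bochner_Integration.integral_cong)
      (auto simp: G_def integral_eq_clamped_lborel[OF cont t])
  also have "\<dots> = (\<integral>r. (\<integral>\<omega>. G \<omega> r \<partial>M) \<partial>lborel)"
    using P.Fubini_integral[OF int] by simp
  also have "\<dots> = (LINT r:{0..t}|lborel. expectation (X r))"
    unfolding set_lebesgue_integral_def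
    by (intro Bochner_Integration.integral_cong) (auto simp: G_def indicator_def)
  finally show ?thesis .
qed

subsection \<open>Laplace transforms\<close>

text \<open>Up to the factor \<open>l\<close>, the integrand is a power times the exponential
  density, so both claims come from the moments of the Erlang density of order 0.\<close>

lemma laplace_power:
  fixes l :: real
  assumes l: "0 < l"
  shows "set_integrable lborel {0..} (\<lambda>s. exp (- l * s) * s ^ n)"
    and "(LINT s:{0..}|lborel. exp (- l * s) * s ^ n) = fact n / l ^ Suc n"
proof -
  have *: "erlang_density 0 l s * s ^ n = l * (indicator {0..} s *\<^sub>R (exp (- l * s) * s ^ n))" for s
    by (auto simp: erlang_density_def)
  have "(\<integral>\<^sup>+s. ennreal (erlang_density 0 l s * s ^ n) \<partial>lborel) = ennreal (fact n / l ^ n)"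
    using nn_integral_erlang_ith_moment[OF l, of 0 n] by simp
  then have "integrable lborel (\<lambda>s. erlang_density 0 l s * s ^ n)"
      "(LINT s|lborel. erlang_density 0 l s * s ^ n) = fact n / l ^ n"
    using l by (subst (asm) nn_integral_eq_integrable, auto simp: erlang_density_def)+
  then show "set_integrable lborel {0..} (\<lambda>s. exp (- l * s) * s ^ n)"
      "(LINT s:{0..}|lborel. exp (- l * s) * s ^ n) = fact n / l ^ Suc n"
    using l unfolding * set_integrable_def set_lebesgue_integral_def by (simp_all add: field_simps)
qed

lemma set_integrable_exp_decay:
  fixes F :: "real \<Rightarrow> real"
  assumes cont: "continuous_on {0..} F" and c: "0 < c"
    and bound: "\<And>s. 0 \<le> s \<Longrightarrow> \<bar>F s\<bar> \<le> C * exp (- c * s)"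
  shows "set_integrable lborel {0..} F"
proof (rule set_integrable_bound)
  show "set_integrable lborel {0..} (\<lambda>s. C * (exp (- c * s) * s ^ 0))"
    by (intro set_integrable_mult_right laplace_power c)
  show "set_borel_measurable lborel {0..} F"
    using borel_measurable_continuous_on_indicator[OF _ cont]
    by (simp add: set_borel_measurable_def)
  have "\<bar>F s\<bar> \<le> \<bar>C * exp (- c * s)\<bar>" if "0 \<le> s" for s
    using bound[OF that] by linarith
  then show "AE s in lborel. s \<in> {0..} \<longrightarrow> norm (F s) \<le> norm (C * (exp (- c * s) * s ^ 0))"
    by (intro AE_I2) auto
qed

text \<open>A single term of the exponential series is below its sum. This matches the growth
  condition of \<open>laplace_unique\<close>.\<close>

lemma power_le_exp_half:
  fixes s :: real
  assumes "0 \<le> s"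
  shows "s ^ n \<le> fact n * 2 ^ n * exp (s / 2)"
proof -
  have sums: "(\<lambda>k. (s / 2) ^ k /\<^sub>R fact k) sums exp (s / 2)"
    by (rule exp_converges)
  have "(\<Sum>k\<in>{n}. (s / 2) ^ k /\<^sub>R fact k) \<le> (\<Sum>k. (s / 2) ^ k /\<^sub>R fact k)"
    using assms by (intro sum_le_suminf sums_summable[OF sums]) auto
  then show ?thesis
    using sums_unique[OF sums] by (simp add: field_simps)
qed

text \<open>The substitution \<open>x = exp (- s)\<close> turns the transforms at integers into
  moments of a continuous function on [0,1]. By Weierstrass approximation, vanishing moments force
  its weighted square integral \<open>I\<close> to be 0, and continuity then gives pointwise
  vanishing.\<close>

lemma laplace_unique:
  fixes D :: "real \<Rightarrow> real"
  assumes cont: "continuous_on {0..} D"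
    and bound: "\<And>s. 0 \<le> s \<Longrightarrow> \<bar>D s\<bar> \<le> C * exp (s / 2)"
    and zero: "\<And>k::nat. 1 \<le> k \<Longrightarrow> (LINT s:{0..}|lborel. exp (- real k * s) * D s) = 0"
    and s: "0 \<le> s"
  shows "D s = 0"
proof -
  \<comment> \<open>By the growth bound, \<open>D (- ln x)\<close> is at most
    \<open>C / sqrt x\<close>. The factor \<open>x\<close> leaves \<open>C * sqrt x\<close>, so 0 is
    the continuous value at 0.\<close>
  define H where "H = (\<lambda>x. if x = 0 then 0 else x * D (- ln x))"
  have C: "0 \<le> C"
    using bound[of 0] by simp
  have Hcont: "continuous_on {0..1} H"
    unfolding continuous_on_def
  proof
    fix x :: real assume x: "x \<in> {0..1}"
    show "(H \<longlongrightarrow> H x) (at x within {0..1})"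
    proof (cases "x = 0")
      case True
      have "\<bar>H y\<bar> \<le> C * sqrt y" if y: "y \<in> {0..1}" for y
      proof (cases "y = 0")
        case False
        then have "0 < y" using y by auto
        have "exp (- ln y / 2) = 1 / sqrt y"
          using \<open>0 < y\<close> by (simp add: ln_sqrt[symmetric] exp_minus field_simps)
        have "\<bar>H y\<bar> = y * \<bar>D (- ln y)\<bar>"
          using \<open>0 < y\<close> by (simp add: H_def abs_mult)
        also have "\<dots> \<le> y * (C * exp (- ln y / 2))"
          using y \<open>0 < y\<close> by (intro mult_left_mono bound) auto
        also have "\<dots> = C * (y / sqrt y)"
          unfolding \<open>exp (- ln y / 2) = 1 / sqrt y\<close> by simp
        also have "y / sqrt y = sqrt y"
          using \<open>0 < y\<close> by (simp add: real_div_sqrt)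
        finally show ?thesis .
      qed (simp add: H_def)
      then have "\<forall>\<^sub>F y in at 0 within {0..1}. norm (H y) \<le> C * sqrt y"
        by (simp add: eventually_at_filter)
      moreover have "((\<lambda>y. C * sqrt y) \<longlongrightarrow> C * sqrt 0) (at 0 within {0..1})"
        by (intro tendsto_intros)
      ultimately show ?thesis
        using True by (auto simp: H_def intro: Lim_null_comparison)
    next
      case False
      then have x: "0 < x" "x \<le> 1" using x by auto
      have "continuous_on {0<..1} (\<lambda>y. y * D (- ln y))"
        by (intro continuous_intros continuous_on_compose2[OF cont]) auto
      then have "((\<lambda>y. y * D (- ln y)) \<longlongrightarrow> H x) (at x within {0<..1})"
        using x by (simp add: continuous_on_def H_def)
      then have "(H \<longlongrightarrow> H x) (at x within {0<..1})"
        by (rule Lim_transform_eventually) (auto simp: eventually_at_filter H_def)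
      moreover have "at x within {0..1} = at x within {0<..1}"
        using x by (intro at_within_nhd[of x "{0<..}"]) auto
      ultimately show ?thesis
        by simp
    qed
  qed
  define G where "G = (\<lambda>s. exp (- s) * D s)"
  have HG: "H (exp (- s)) = G s" for s
    by (simp add: H_def G_def)
  have Gcont: "continuous_on {0..} G"
    unfolding G_def by (intro continuous_intros cont)
  have Gb: "\<bar>G s\<bar> \<le> C" if "0 \<le> s" for s
  proof -
    have "\<bar>G s\<bar> \<le> exp (- s) * (C * exp (s / 2))"
      using bound[OF that] by (simp add: G_def abs_mult)
    also have "\<dots> = C * exp (- (s / 2))"
      by (simp add: exp_add[symmetric])
    also have "\<dots> \<le> C * 1"
      using that C by (intro mult_left_mono) auto
    finally show ?thesis by simp
  qed
  define I where "I = (LINT s:{0..}|lborel. exp (- s) * (G s)\<^sup>2)"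
  have int0: "set_integrable lborel {0..} (\<lambda>s. exp (- s) * K s)"
    if "continuous_on {0..} K" "\<And>s. 0 \<le> s \<Longrightarrow> \<bar>K s\<bar> \<le> A" for K :: "real \<Rightarrow> real" and A
    by (rule set_integrable_exp_decay[of _ 1 A]) (use that in \<open>auto simp: abs_mult intro!:
        continuous_intros\<close>)
  have intI: "set_integrable lborel {0..} (\<lambda>s. exp (- s) * (G s)\<^sup>2)"
  proof (rule int0)
    show "\<bar>(G s)\<^sup>2\<bar> \<le> C\<^sup>2" if "0 \<le> s" for s
      using power_mono[OF Gb[OF that], of 2] by simp
  qed (intro continuous_intros Gcont)
  have intG: "set_integrable lborel {0..} (\<lambda>s. exp (- s) * \<bar>G s\<bar>)"
    using Gb by (intro int0 continuous_intros Gcont) auto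
  \<comment> \<open>One factor \<open>G\<close> of the square is replaced by a polynomial in
    \<open>exp (- s)\<close>, with error at most \<open>e\<close>. The integral with the polynomial
    vanishes by the hypothesis on integer transforms.\<close>
  have le: "I \<le> e * (LINT s:{0..}|lborel. exp (- s) * \<bar>G s\<bar>)" if e: "0 < e" for e
  proof -
    obtain p where p: "real_polynomial_function p" "\<And>x. x \<in> {0..1} \<Longrightarrow> \<bar>H x - p x\<bar> < e"
      using Stone_Weierstrass_real_polynomial_function[OF compact_Icc Hcont e] by metis
    obtain a n where pa: "p = (\<lambda>x. \<Sum>i\<le>n. a i * x ^ i)"
      using p(1) real_polynomial_function_iff_sum by blast
    \<comment> \<open>In the exponent \<open>i + 2\<close>, one unit comes from the weight
      \<open>exp (- s)\<close>, one from \<open>G\<close>, and \<open>i\<close> from the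
      monomial.\<close>
    have intD: "set_integrable lborel {0..} (\<lambda>s. a i * (exp (- real (i + 2) * s) * D s))" for i
    proof -
      have "set_integrable lborel {0..} (\<lambda>s. exp (- s) * (exp (- s) ^ i * G s))"
      proof (rule int0)
        show "\<bar>exp (- s) ^ i * G s\<bar> \<le> 1 * C" if "0 \<le> s" for s
          unfolding abs_mult using that by (intro mult_mono Gb) (auto simp: power_le_one)
      qed (intro continuous_intros Gcont)
      moreover have "exp (- s) * (exp (- s) ^ i * G s) = exp (- real (i + 2) * s) * D s" for s
        by (simp add: G_def exp_of_nat_mult[symmetric] exp_add[symmetric] algebra_simps
            mult_exp_exp)
      ultimately show ?thesis
        by (intro set_integrable_mult_right) simp
    qed
    have eqp: "exp (- s) * (G s * p (exp (- s)))
        = (\<Sum>i\<le>n. a i * (exp (- real (i + 2) * s) * D s))" for s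
    proof -
      have "exp (- s) * (G s * (a i * exp (- s) ^ i))
          = a i * (exp (- real (i + 2) * s) * D s)" for i
        by (simp add: G_def exp_of_nat_mult[symmetric] exp_add[symmetric] algebra_simps
            mult_exp_exp)
      then show ?thesis
        unfolding pa sum_distrib_left by (intro sum.cong) auto
    qed
    have intp: "set_integrable lborel {0..} (\<lambda>s. exp (- s) * (G s * p (exp (- s))))"
      unfolding eqp using intD unfolding set_integrable_def
      by (simp only: scaleR_sum_right) (intro Bochner_Integration.integrable_sum)
    have "(LINT s:{0..}|lborel. exp (- s) * (G s * p (exp (- s))))
        = (\<Sum>i\<le>n. LINT s:{0..}|lborel. a i * (exp (- real (i + 2) * s) * D s))"
      unfolding eqp using intD unfolding set_integrable_def set_lebesgue_integral_def
      by (simp only: scaleR_sum_right) (intro Bochner_Integration.integral_sum)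
    also have "\<dots> = 0"
    proof (intro sum.neutral ballI)
      fix i
      show "(LINT s:{0..}|lborel. a i * (exp (- real (i + 2) * s) * D s)) = 0"
        using zero[of "i + 2"] by (simp only: set_integral_mult_right)
    qed
    finally have p0: "(LINT s:{0..}|lborel. exp (- s) * (G s * p (exp (- s)))) = 0" .
    have "I = (LINT s:{0..}|lborel. exp (- s) * (G s)\<^sup>2 - exp (- s) * (G s * p (exp (- s))))"
      using set_integral_diff(2)[OF intI intp] p0 by (simp add: I_def)
    also have "\<dots> \<le> (LINT s:{0..}|lborel. e * (exp (- s) * \<bar>G s\<bar>))"
    proof (rule set_integral_mono)
      show "set_integrable lborel {0..} (\<lambda>s. e * (exp (- s) * \<bar>G s\<bar>))"
        by (intro set_integrable_mult_right intG)
      fix s :: real assume "s \<in> {0..}"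
      then have "\<bar>G s - p (exp (- s))\<bar> \<le> e"
        using p(2)[of "exp (- s)"] by (simp add: HG)
      then have "\<bar>G s\<bar> * \<bar>G s - p (exp (- s))\<bar> \<le> \<bar>G s\<bar> * e"
        by (intro mult_left_mono) auto
      then have "G s * (G s - p (exp (- s))) \<le> \<bar>G s\<bar> * e"
        by (metis abs_ge_self abs_mult order_trans)
      then have "exp (- s) * (G s * (G s - p (exp (- s)))) \<le> exp (- s) * (\<bar>G s\<bar> * e)"
        by (intro mult_left_mono) auto
      then show "exp (- s) * (G s)\<^sup>2 - exp (- s) * (G s * p (exp (- s))) \<le> e * (exp (- s) * \<bar>G s\<bar>)"
        by (simp add: algebra_simps power2_eq_square)
    qed (intro set_integral_diff intI intp)
    finally show ?thesis
      by simp
  qed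
  have "I \<le> 0"
  proof (rule tendsto_lowerbound)
    let ?K = "LINT s:{0..}|lborel. exp (- s) * \<bar>G s\<bar>"
    have "((\<lambda>e. e * ?K) \<longlongrightarrow> 0 * ?K) (at_right 0)"
      by (intro tendsto_intros)
    then show "((\<lambda>e. e * ?K) \<longlongrightarrow> 0) (at_right 0)"
      by simp
    show "\<forall>\<^sub>F e in at_right 0. I \<le> e * ?K"
      using le by (auto simp: eventually_at_filter)
  qed simp
  \<comment> \<open>The interval keeps positive length even for \<open>s = 0\<close>, as needed to
    conclude that a nonnegative continuous function with zero integral vanishes.\<close>
  define T where "T = s + 1"
  have sub: "set_integrable lborel {0..T} (\<lambda>s. exp (- s) * (G s)\<^sup>2)"
    by (rule set_integrable_subset[OF intI]) auto
  have "integral {0..T} (\<lambda>s. exp (- s) * (G s)\<^sup>2) = (LINT s:{0..T}|lborel. exp (- s) * (G s)\<^sup>2)"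
    using set_borel_integral_eq_integral(2)[OF sub] by simp
  also have "\<dots> \<le> I"
    unfolding I_def using sub intI unfolding set_lebesgue_integral_def set_integrable_def
    by (intro integral_mono) (auto simp: indicator_def)
  finally have "integral {0..T} (\<lambda>s. exp (- s) * (G s)\<^sup>2) \<le> 0"
    using \<open>I \<le> 0\<close> by simp
  moreover have c: "continuous_on {0..T} (\<lambda>s. exp (- s) * (G s)\<^sup>2)"
    by (intro continuous_intros continuous_on_subset[OF Gcont]) auto
  moreover have "0 \<le> integral {0..T} (\<lambda>s. exp (- s) * (G s)\<^sup>2)"
    by (intro integral_nonneg integrable_continuous_real c) auto
  ultimately have "\<forall>r\<in>{0..T}. exp (- r) * (G r)\<^sup>2 = 0"
    using integral_eq_0_iff[OF c] s by (simp add: T_def)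
  then show ?thesis
    using s by (simp add: T_def G_def)
qed

text \<open>A power series with a nonzero coefficient of positive order that vanishes at 0 has no
  other zero near 0, so it cannot vanish on a whole interval.\<close>

lemma powser_real_zero_coeffs:
  fixes d :: "nat \<Rightarrow> real"
  assumes "\<And>x. \<bar>x\<bar> < 1 \<Longrightarrow> (\<lambda>n. d n * x ^ n) sums 0"
  shows "d n = 0"
proof (rule ccontr)
  assume n: "d n \<noteq> 0"
  have "n > 0"
    using assms[of 0] n by (cases n) auto
  show False
  proof (rule powser_0_nonzero[of 1 0 d "\<lambda>_. 0" n])
    fix s :: real assume "0 < s" "\<And>z::real. z \<in> cball 0 s - {0} \<Longrightarrow> (0::real) \<noteq> 0"
    from this(1) this(2)[of s] show False
      by simp
  qed (use assms n \<open>n > 0\<close> in auto)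
qed

subsection \<open>Continuous functions along paths of the spider\<close>

definition spider_coord :: "nat \<Rightarrow> nat \<times> real \<Rightarrow> real" where
  "spider_coord i p = (if fst p = i then snd p else 0)"

text \<open>Because \<open>leg_pt\<close> sends 0 to the common origin on every leg, continuity leg
  by leg includes continuity at the gluing point.\<close>

definition spider_continuous :: "nat \<Rightarrow> (nat \<times> real \<Rightarrow> real) \<Rightarrow> bool" where
  "spider_continuous N F \<longleftrightarrow> (\<forall>i\<in>{1..N}. continuous_on {0..} (\<lambda>x. F (leg_pt i x)))"

lemma spider_pts_cases:
  assumes "p \<in> spider_pts N"
  obtains "p = spider_origin" | i x where "p = (i, x)" "i \<in> {1..N}" "x > 0"
  using assms by (auto simp: spider_pts_def)

lemma spider_coord_nonneg: "p \<in> spider_pts N \<Longrightarrow> 0 \<le> spider_coord i p"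
  by (auto simp: spider_pts_def spider_coord_def spider_origin_def)

text \<open>Points on different legs are at distance the sum of their radii, which dominates the
  change of any single coordinate.\<close>

lemma spider_coord_lipschitz:
  assumes "p \<in> spider_pts N" "q \<in> spider_pts N"
  shows "\<bar>spider_coord i p - spider_coord i q\<bar> \<le> spider_dist p q"
  using assms by (auto simp: spider_pts_def spider_coord_def spider_origin_def spider_dist_def)

text \<open>The leg number is not continuous along a path, but every coordinate \<open>spider_coord i\<close> is. This
  representation reduces path continuity and measurability to the coordinates.\<close>
lemma spider_decomp:
  fixes F :: "nat \<times> real \<Rightarrow> real"
  assumes "p \<in> spider_pts N"
  shows "F p = F spider_origin + (\<Sum>i=1..N. F (leg_pt i (spider_coord i p)) - F spider_origin)"
  using assms
proof (cases rule: spider_pts_cases)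
  case 1
  then show ?thesis
    by (simp add: spider_coord_def spider_origin_def leg_pt_def)
next
  case (2 j x)
  have "(\<Sum>i=1..N. F (leg_pt i (spider_coord i p)) - F spider_origin)
      = (\<Sum>i=1..N. if i = j then F p - F spider_origin else 0)"
    using 2 by (intro sum.cong) (auto simp: spider_coord_def leg_pt_def)
  then show ?thesis
    using 2 by simp
qed

section \<open>Regularity of the process and its natural filtration\<close>

locale kirchhoff_spider =
  fixes N :: nat and M :: "'w measure" and b :: "real \<Rightarrow> 'w \<Rightarrow> nat \<times> real"
  assumes legs: "1 \<le> N" and BM: "spider_BM N M b"
    and start: "\<And>\<omega>. \<omega> \<in> space M \<Longrightarrow> b 0 \<omega> = spider_origin"
begin

sublocale prob_space M
  using BM by (simp add: spider_BM_def)

lemma b_measurable: "0 \<le> s \<Longrightarrow> b s \<in> measurable M spider_space"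
  using BM by (simp add: spider_BM_def)

lemma b_pts: "\<omega> \<in> space M \<Longrightarrow> 0 \<le> s \<Longrightarrow> b s \<omega> \<in> spider_pts N"
  using BM by (simp add: spider_BM_def)

lemma b_coord_nonneg: "\<omega> \<in> space M \<Longrightarrow> 0 \<le> s \<Longrightarrow> 0 \<le> spider_coord i (b s \<omega>)"
  by (rule spider_coord_nonneg[OF b_pts])

lemma spider_coord_continuous_path:
  assumes "\<omega> \<in> space M"
  shows "continuous_on {0..} (\<lambda>s. spider_coord i (b s \<omega>))"
  unfolding continuous_on_iff
proof (intro ballI allI impI)
  fix s e :: real assume s: "s \<in> {0..}" and e: "0 < e"
  have "continuous_spider_path (\<lambda>s. b s \<omega>)"
    using BM assms by (simp add: spider_BM_def)
  then obtain d where d: "d > 0"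
      "\<And>s'. s' \<ge> 0 \<Longrightarrow> \<bar>s' - s\<bar> < d \<Longrightarrow> spider_dist (b s' \<omega>) (b s \<omega>) < e"
    using s e unfolding continuous_spider_path_def by (meson atLeast_iff)
  show "\<exists>d>0. \<forall>s'\<in>{0..}. dist s' s < d \<longrightarrow>
      dist (spider_coord i (b s' \<omega>)) (spider_coord i (b s \<omega>)) < e"
  proof (intro exI[of _ d] conjI ballI impI)
    fix s' assume s': "s' \<in> {0..}" "dist s' s < d"
    then have "\<bar>spider_coord i (b s' \<omega>) - spider_coord i (b s \<omega>)\<bar> \<le> spider_dist (b s' \<omega>) (b s \<omega>)"
      using s assms by (intro spider_coord_lipschitz[OF b_pts b_pts]) auto
    then show "dist (spider_coord i (b s' \<omega>)) (spider_coord i (b s \<omega>)) < e"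
      using d(2)[of s'] s' by (simp add: dist_real_def)
  qed (rule d)
qed

lemma spider_continuous_path:
  assumes "\<omega> \<in> space M" "spider_continuous N F"
  shows "continuous_on {0..} (\<lambda>s. F (b s \<omega>))"
proof -
  have "continuous_on {0..} (\<lambda>s. F spider_origin
      + (\<Sum>i=1..N. F (leg_pt i (spider_coord i (b s \<omega>))) - F spider_origin))"
  proof (intro continuous_intros)
    fix i assume "i \<in> {1..N}"
    then have "continuous_on {0..} (\<lambda>x. F (leg_pt i x))"
      using assms(2) by (simp add: spider_continuous_def)
    then show "continuous_on {0..} (\<lambda>s. F (leg_pt i (spider_coord i (b s \<omega>))))"
      by (rule continuous_on_compose2)
        (use assms(1) in \<open>auto intro: spider_coord_continuous_path b_coord_nonneg\<close>)
  qed
  then show ?thesis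
    by (rule continuous_on_eq) (rule spider_decomp[OF b_pts[OF assms(1)], symmetric], simp)
qed

text \<open>The measure \<open>G\<close> is kept general so that the result serves both
  \<open>M\<close> and the members of the filtration. Inserting \<open>max 0\<close> extends the
  function on a leg continuously to the real line without changing it at nonnegative
  coordinates.\<close>

lemma spider_continuous_measurable:
  assumes "space G = space M" "0 \<le> r" "b r \<in> measurable G spider_space" "spider_continuous N F"
  shows "(\<lambda>\<omega>. F (b r \<omega>)) \<in> borel_measurable G"
proof -
  have [measurable]: "b r \<in> measurable G (count_space UNIV \<Otimes>\<^sub>M borel)"
    using assms(3) by (simp add: spider_space_def)
  have [measurable]: "(\<lambda>\<omega>. spider_coord i (b r \<omega>)) \<in> borel_measurable G" for i
    unfolding spider_coord_def by measurable
  have [measurable]: "(\<lambda>\<omega>. F (leg_pt i (spider_coord i (b r \<omega>)))) \<in> borel_measurable G"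
    if "i \<in> {1..N}" for i
  proof -
    have "continuous_on {0..} (\<lambda>x. F (leg_pt i x))"
      using assms(4) that by (simp add: spider_continuous_def)
    then have "continuous_on UNIV (\<lambda>x. F (leg_pt i (max 0 x)))"
      by (rule continuous_on_compose2) (auto intro!: continuous_intros)
    then have "(\<lambda>x. F (leg_pt i (max 0 x))) \<in> borel_measurable borel"
      by (rule borel_measurable_continuous_onI)
    then have "(\<lambda>\<omega>. F (leg_pt i (max 0 (spider_coord i (b r \<omega>))))) \<in> borel_measurable G"
      by measurable
    then show ?thesis
      by (subst measurable_cong)
        (use assms(1,2) b_coord_nonneg in \<open>auto simp: max_absorb2\<close>)
  qed
  have "(\<lambda>\<omega>. F spider_origin + (\<Sum>i=1..N. F (leg_pt i (spider_coord i (b r \<omega>))) - F spider_origin))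
      \<in> borel_measurable G"
    by measurable
  then show ?thesis
    by (subst measurable_cong[OF spider_decomp[OF b_pts[OF _ assms(2)]]]) (simp_all add: assms(1))
qed

text \<open>Packages the family of sets as a measure object, as conditional expectations require;
  only its space and its sets matter.\<close>

definition Filt :: "real \<Rightarrow> 'w measure" where
  "Filt s = sigma (space M) (nat_filtration M b s)"

lemma space_Filt[simp]: "space (Filt s) = space M"
  by (simp add: Filt_def space_measure_of_conv)

lemma nat_filtration_subset: "nat_filtration M b s \<subseteq> sets M"
  unfolding nat_filtration_def
  by (rule sets.sigma_sets_subset) (use b_measurable in \<open>auto intro: measurable_sets\<close>)

lemma sets_Filt: "sets (Filt s) = nat_filtration M b s"
proof -
  have sub: "nat_filtration M b s \<subseteq> Pow (space M)"
    using nat_filtration_subset sets.sets_into_space by blast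
  then have "sets (Filt s) = sigma_sets (space M) (nat_filtration M b s)"
    by (simp add: Filt_def)
  also have "\<dots> = nat_filtration M b s"
    unfolding nat_filtration_def by (rule sigma_sets_sigma_sets_eq) auto
  finally show ?thesis .
qed

lemma subalgebra_Filt: "subalgebra M (Filt s)"
  using nat_filtration_subset by (simp add: subalgebra_def sets_Filt)

lemma b_measurable_Filt: "0 \<le> r \<Longrightarrow> r \<le> s \<Longrightarrow> b r \<in> measurable (Filt s) spider_space"
  by (rule measurableI)
    (auto simp: sets_Filt nat_filtration_def spider_space_def space_pair_measure
      intro!: sigma_sets.Basic)

text \<open>The martingale property is given only against indicators. It says that the increment has
  conditional expectation 0, and a bounded factor measurable at time \<open>s\<close> can be pulled
  out of that conditional expectation.\<close>

lemma martingale_orthogonal: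
  assumes X: "is_martingale M b X" and s: "0 \<le> s" "s \<le> t"
    and Y: "Y \<in> borel_measurable (Filt s)" "\<And>\<omega>. \<omega> \<in> space M \<Longrightarrow> \<bar>Y \<omega>\<bar> \<le> B"
  shows "expectation (\<lambda>\<omega>. Y \<omega> * (X t \<omega> - X s \<omega>)) = 0"
proof -
  interpret finite_measure_subalgebra M "Filt s"
    by unfold_locales (rule subalgebra_Filt)
  have int[simp]: "integrable M (X t)" "integrable M (X s)"
    using X s by (auto simp: is_martingale_def)
  have [measurable]: "X t \<in> borel_measurable M" "X s \<in> borel_measurable M"
    using int by (auto simp del: int)
  have [measurable]: "Y \<in> borel_measurable M"
    using measurable_from_subalg[OF subalg Y(1)] .
  have intY: "integrable M (\<lambda>\<omega>. Y \<omega> * (X t \<omega> - X s \<omega>))"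
  proof (rule Bochner_Integration.integrable_bound)
    show "integrable M (\<lambda>\<omega>. B * (X t \<omega> - X s \<omega>))"
      by simp
    show "AE \<omega> in M. norm (Y \<omega> * (X t \<omega> - X s \<omega>)) \<le> norm (B * (X t \<omega> - X s \<omega>))"
      using Y(2) by (intro AE_I2) (fastforce simp: abs_mult intro: mult_right_mono)
  qed measurable
  have "AE \<omega> in M. real_cond_exp M (Filt s) (\<lambda>\<omega>. X t \<omega> - X s \<omega>) \<omega> = 0"
  proof (rule real_cond_exp_charact)
    fix A assume "A \<in> sets (Filt s)"
    then show "(\<integral>\<omega>\<in>A. X t \<omega> - X s \<omega> \<partial>M) = (\<integral>\<omega>\<in>A. 0 \<partial>M)"
      using X s by (simp add: is_martingale_def sets_Filt set_lebesgue_integral_def)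
  qed auto
  then have "expectation (\<lambda>\<omega>. Y \<omega> * real_cond_exp M (Filt s) (\<lambda>\<omega>. X t \<omega> - X s \<omega>) \<omega>)
      = expectation (\<lambda>_. 0)"
    by (intro integral_cong_AE) auto
  then show ?thesis
    using real_cond_exp_intg(2)[OF intY Y(1)] by simp
qed

end

subsection \<open>The Feynman-Kac formula\<close>

lemma integral_abs_bound:
  fixes g :: "real \<Rightarrow> real"
  assumes "continuous_on {0..t} g" "\<And>r. r \<in> {0..t} \<Longrightarrow> \<bar>g r\<bar> \<le> B" "0 \<le> t"
  shows "\<bar>integral {0..t} g\<bar> \<le> B * t"
  using integral_bound[OF assms(3,1), of B] assms(2) by simp

lemma spider_continuous_kirchhoff_dom:
  assumes "kirchhoff_dom N f d1 d2"
  shows "spider_continuous N f"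
  unfolding spider_continuous_def
proof
  fix i assume "i \<in> {1..N}"
  then have "C2c_half_line (\<lambda>x. f (leg_pt i x)) (d1 i) (d2 i)"
    using assms by (simp add: kirchhoff_dom_def)
  then show "continuous_on {0..} (\<lambda>x. f (leg_pt i x))"
    unfolding C2c_half_line_def by (intro DERIV_continuous_on[of _ _ "d1 i"]) auto
qed

text \<open>At the origin \<open>spider_gen\<close> reads the second derivative of leg 1. Continuity
  there rests on the agreement of all second derivatives at 0 in
  \<open>kirchhoff_dom\<close>.\<close>

lemma spider_continuous_spider_gen:
  assumes "kirchhoff_dom N f d1 d2"
  shows "spider_continuous N (spider_gen d2)"
  unfolding spider_continuous_def
proof
  fix i assume i: "i \<in> {1..N}"
  then have "C2c_half_line (\<lambda>x. f (leg_pt i x)) (d1 i) (d2 i)"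
    using assms by (simp add: kirchhoff_dom_def)
  then have "continuous_on {0..} (\<lambda>x. d2 i x / 2)"
    unfolding C2c_half_line_def by (intro continuous_intros) auto
  moreover have "d2 i 0 = d2 1 0"
    using assms i unfolding kirchhoff_dom_def by (metis atLeastAtMost_iff le_trans order_refl)
  then have "spider_gen d2 (leg_pt i x) = d2 i x / 2" for x
    using i by (auto simp: spider_gen_def leg_pt_def spider_origin_def)
  ultimately show "continuous_on {0..} (\<lambda>x. spider_gen d2 (leg_pt i x))"
    by (simp only:)
qed

context kirchhoff_spider
begin

definition time_integral :: "(nat \<times> real \<Rightarrow> real) \<Rightarrow> real \<Rightarrow> 'w \<Rightarrow> real" where
  "time_integral F s \<omega> = integral {0..s} (\<lambda>r. F (b r \<omega>))"

lemma spider_continuous_path_upto: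
  "\<omega> \<in> space M \<Longrightarrow> spider_continuous N F \<Longrightarrow> continuous_on {0..t} (\<lambda>s. F (b s \<omega>))"
  by (rule continuous_on_subset[OF spider_continuous_path]) auto

lemma time_integral_deriv:
  assumes "\<omega> \<in> space M" "spider_continuous N F" "s \<in> {0..t}"
  shows "((\<lambda>s. time_integral F s \<omega>) has_real_derivative F (b s \<omega>)) (at s within {0..t})"
  unfolding time_integral_def
  by (rule integral_has_real_derivative[OF spider_continuous_path_upto]) (use assms in auto)

lemma time_integral_continuous:
  assumes "\<omega> \<in> space M" "spider_continuous N F"
  shows "continuous_on {0..t} (\<lambda>s. time_integral F s \<omega>)"
  by (rule DERIV_continuous_on[OF time_integral_deriv]) (use assms in auto)

lemma time_integral_measurable_Filt:
  assumes "0 \<le> s" "spider_continuous N F"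
  shows "time_integral F s \<in> borel_measurable (Filt s)"
  unfolding time_integral_def
  by (rule borel_measurable_time_integral)
    (use assms spider_continuous_path_upto in \<open>auto intro: spider_continuous_measurable
        b_measurable_Filt\<close>)

lemma Filt_measurable: "X \<in> borel_measurable (Filt s) \<Longrightarrow> X \<in> borel_measurable M"
  by (rule measurable_from_subalg[OF subalgebra_Filt])

lemma time_integral_bound:
  assumes "\<omega> \<in> space M" "spider_continuous N F" "0 \<le> s" "\<And>p. p \<in> spider_pts N \<Longrightarrow> \<bar>F p\<bar> \<le> B"
  shows "\<bar>time_integral F s \<omega>\<bar> \<le> B * s"
  unfolding time_integral_def
  by (rule integral_abs_bound) (use assms b_pts in \<open>auto intro: spider_continuous_path_upto\<close>)

text \<open>The expectation of the pathwise identity. The factor \<open>v (b r) * Z r\<close> is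
  bounded and known at time \<open>r\<close>, hence orthogonal to \<open>X t - X r\<close>; Fubini
  then removes the whole correction term.\<close>

lemma feynman_kac:
  assumes dom: "kirchhoff_dom N f d1 d2" and v: "spider_continuous N v" and t: "0 \<le> t"
    and bv: "\<And>p. p \<in> spider_pts N \<Longrightarrow> \<bar>v p\<bar> \<le> B"
    and bf: "\<And>p. p \<in> spider_pts N \<Longrightarrow> \<bar>f p\<bar> \<le> B"
    and bg: "\<And>p. p \<in> spider_pts N \<Longrightarrow> \<bar>spider_gen d2 p\<bar> \<le> B"
  shows "expectation (\<lambda>\<omega>. exp (- time_integral v t \<omega>) * f (b t \<omega>)) - f spider_origin
    = expectation (\<lambda>\<omega>. integral {0..t} (\<lambda>r. exp (- time_integral v r \<omega>)
        * (spider_gen d2 (b r \<omega>) - v (b r \<omega>) * f (b r \<omega>))))"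
proof -
  note f = spider_continuous_kirchhoff_dom[OF dom] and g = spider_continuous_spider_gen[OF dom]
  define Z where "Z = (\<lambda>r \<omega>. exp (- time_integral v r \<omega>))"
  define X where "X = (\<lambda>r \<omega>. f (b r \<omega>) - f (b 0 \<omega>) - time_integral (spider_gen d2) r \<omega>)"
  have mart: "is_martingale M b X"
    using BM dom unfolding spider_BM_def X_def time_integral_def by blast
  have B0: "0 \<le> B"
    using bv[of spider_origin] by (simp add: spider_pts_def)
  have Zm: "Z r \<in> borel_measurable (Filt r)" if "r \<in> {0..t}" for r
    using time_integral_measurable_Filt[OF _ v, of r] that unfolding Z_def by simp
  have vm: "(\<lambda>\<omega>. v (b r \<omega>)) \<in> borel_measurable (Filt r)"
      "(\<lambda>\<omega>. f (b r \<omega>)) \<in> borel_measurable (Filt r)" if "r \<in> {0..t}" for r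
    using that f v by (auto intro: spider_continuous_measurable b_measurable_Filt)
  have Xm: "X r \<in> borel_measurable M" if "r \<in> {0..t}" for r
    using mart that by (auto simp: is_martingale_def)
  have Zb: "\<bar>Z r \<omega>\<bar> \<le> exp (B * t)" if "r \<in> {0..t}" "\<omega> \<in> space M" for r \<omega>
  proof -
    have "\<bar>time_integral v r \<omega>\<bar> \<le> B * r"
      using that by (intro time_integral_bound v bv) auto
    also have "\<dots> \<le> B * t"
      using that B0 by (intro mult_left_mono) auto
    finally show ?thesis
      by (simp add: Z_def)
  qed
  have Xb: "\<bar>X r \<omega>\<bar> \<le> 2 * B + B * t" if "r \<in> {0..t}" "\<omega> \<in> space M" for r \<omega>
  proof -
    have "\<bar>time_integral (spider_gen d2) r \<omega>\<bar> \<le> B * r"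
      using that by (intro time_integral_bound g bg) auto
    also have "\<dots> \<le> B * t"
      using that B0 by (intro mult_left_mono) auto
    finally have "\<bar>time_integral (spider_gen d2) r \<omega>\<bar> \<le> B * t" .
    moreover have "\<bar>f (b r \<omega>)\<bar> \<le> B" "\<bar>f (b 0 \<omega>)\<bar> \<le> B"
      using that by (auto intro!: bf b_pts)
    ultimately show ?thesis
      unfolding X_def by linarith
  qed
  define K where "K = B * exp (B * t) * (2 * (2 * B + B * t))"
  define W where "W = (\<lambda>r \<omega>. v (b r \<omega>) * Z r \<omega> * (X t \<omega> - X r \<omega>))"
  have Wb: "\<bar>W r \<omega>\<bar> \<le> K" if "r \<in> {0..t}" "\<omega> \<in> space M" for r \<omega>
  proof -
    have "\<bar>X t \<omega> - X r \<omega>\<bar> \<le> 2 * (2 * B + B * t)"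
      using Xb[OF that] Xb[of t \<omega>] that t by auto
    moreover have "\<bar>v (b r \<omega>)\<bar> \<le> B"
      using that by (auto intro!: bv b_pts)
    ultimately show ?thesis
      unfolding W_def K_def abs_mult using Zb[OF that] B0 by (intro mult_mono) auto
  qed
  have Wm: "W r \<in> borel_measurable M" if r: "r \<in> {0..t}" for r
  proof -
    have [measurable]: "(\<lambda>\<omega>. v (b r \<omega>)) \<in> borel_measurable M" "Z r \<in> borel_measurable M"
        "X t \<in> borel_measurable M" "X r \<in> borel_measurable M"
      using r t by (auto intro: Xm Filt_measurable[OF Zm] Filt_measurable[OF vm(1)])
    show ?thesis
      unfolding W_def by measurable
  qed
  have cont: "continuous_on {0..t} (\<lambda>r. Z r \<omega>)" "continuous_on {0..t} (\<lambda>r. X r \<omega>)"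
      "continuous_on {0..t} (\<lambda>r. W r \<omega>)" if \<omega>: "\<omega> \<in> space M" for \<omega>
  proof -
    note [continuous_intros] = time_integral_continuous[OF \<omega> v] time_integral_continuous[OF \<omega> g]
      spider_continuous_path_upto[OF \<omega> v] spider_continuous_path_upto[OF \<omega> f]
    show Z: "continuous_on {0..t} (\<lambda>r. Z r \<omega>)"
      unfolding Z_def by (intro continuous_intros)
    show X: "continuous_on {0..t} (\<lambda>r. X r \<omega>)"
      unfolding X_def by (intro continuous_intros)
    show "continuous_on {0..t} (\<lambda>r. W r \<omega>)"
      unfolding W_def by (intro continuous_intros Z X)
  qed
  have W0: "expectation (W r) = 0" if r: "r \<in> {0..t}" for r
    unfolding W_def
  proof (rule martingale_orthogonal[OF mart])
    show "(\<lambda>\<omega>. v (b r \<omega>) * Z r \<omega>) \<in> borel_measurable (Filt r)"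
      using vm(1)[OF r] Zm[OF r] by simp
    show "\<bar>v (b r \<omega>) * Z r \<omega>\<bar> \<le> B * exp (B * t)" if "\<omega> \<in> space M" for \<omega>
      unfolding abs_mult using Zb[OF r that] r that by (intro mult_mono bv b_pts B0) auto
  qed (use r in auto)
  have EW: "expectation (\<lambda>\<omega>. integral {0..t} (\<lambda>r. W r \<omega>)) = 0"
  proof -
    have "(LINT r:{0..t}|lborel. expectation (W r)) = (LINT r:{0..t}|lborel. 0)"
      using W0 by (intro set_lebesgue_integral_cong) auto
    then show ?thesis
      using expectation_time_integral[OF t Wm cont(3) Wb] by (simp add: set_lebesgue_integral_def)
  qed
  have intW: "integrable M (\<lambda>\<omega>. integral {0..t} (\<lambda>r. W r \<omega>))"
    by (rule integrable_const_bound[of _ "K * t"])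
      (use t Wm Wb cont(3) in \<open>auto intro!: AE_I2 integral_abs_bound
          borel_measurable_time_integral\<close>)
  have EX: "expectation (X t) = 0"
  proof -
    have "X 0 \<omega> = 0" for \<omega>
      by (simp add: X_def time_integral_def)
    then show ?thesis
      using martingale_orthogonal[OF mart order_refl t, of "\<lambda>_. 1" 1] by simp
  qed
  have intZ: "integrable M (\<lambda>\<omega>. Z t \<omega> * f (b t \<omega>))"
  proof (rule integrable_const_bound[of _ "exp (B * t) * B"])
    show "AE \<omega> in M. norm (Z t \<omega> * f (b t \<omega>)) \<le> exp (B * t) * B"
      using Zb t by (intro AE_I2) (auto simp: abs_mult intro!: mult_mono bf b_pts)
    have [measurable]: "(\<lambda>\<omega>. f (b t \<omega>)) \<in> borel_measurable M" "Z t \<in> borel_measurable M"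
      using t by (auto intro: Filt_measurable[OF Zm] Filt_measurable[OF vm(2)])
    show "(\<lambda>\<omega>. Z t \<omega> * f (b t \<omega>)) \<in> borel_measurable M"
      by measurable
  qed
  have path: "integral {0..t} (\<lambda>r. Z r \<omega> * (spider_gen d2 (b r \<omega>) - v (b r \<omega>) * f (b r \<omega>)))
      = Z t \<omega> * f (b t \<omega>) - f spider_origin - X t \<omega> + integral {0..t} (\<lambda>r. W r \<omega>)"
    if \<omega>: "\<omega> \<in> space M" for \<omega>
  proof -
    \<comment> \<open>\<open>X t\<close> is frozen in place of \<open>X r\<close>, so that
      \<open>G\<close> is differentiable in \<open>r\<close> and the ordinary fundamental theorem of
      calculus applies. Adding \<open>W\<close> undoes the exchange under the integral.\<close>
    define G where "G = (\<lambda>r. Z r \<omega> * (f spider_origin + X t \<omega> + time_integral (spider_gen d2) r \<omega>))"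
    define H where "H = (\<lambda>r. Z r \<omega> * (spider_gen d2 (b r \<omega>)
        - v (b r \<omega>) * (f spider_origin + X t \<omega> + time_integral (spider_gen d2) r \<omega>)))"
    have "(G has_real_derivative H r) (at r within {0..t})" if "r \<in> {0..t}" for r
      unfolding G_def H_def Z_def
      by (rule derivative_eq_intros time_integral_deriv[OF \<omega> v that] time_integral_deriv[OF \<omega> g
          that] refl)+
        (simp add: algebra_simps)
    then have "(H has_integral G t - G 0) {0..t}"
      using t by (intro fundamental_theorem_of_calculus)
        (auto simp: has_real_derivative_iff_has_vector_derivative)
    moreover have "((\<lambda>r. W r \<omega>) has_integral integral {0..t} (\<lambda>r. W r \<omega>)) {0..t}"
      by (intro integrable_integral integrable_continuous_real cont \<omega>)
    ultimately have "((\<lambda>r. H r + W r \<omega>) has_integral G t - G 0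
        + integral {0..t} (\<lambda>r. W r \<omega>)) {0..t}"
      by (rule has_integral_add)
    moreover have "H r + W r \<omega> = Z r \<omega> * (spider_gen d2 (b r \<omega>) - v (b r \<omega>) * f (b r \<omega>))" for r
      using start[OF \<omega>] by (simp add: H_def W_def X_def algebra_simps)
    moreover have "G t - G 0 = Z t \<omega> * f (b t \<omega>) - f spider_origin - X t \<omega>"
      using start[OF \<omega>] by (simp add: G_def X_def time_integral_def Z_def algebra_simps)
    ultimately show ?thesis
      by (auto dest!: integral_unique)
  qed
  have "expectation (\<lambda>\<omega>. integral {0..t} (\<lambda>r. Z r \<omega> * (spider_gen d2 (b r \<omega>) - v (b r \<omega>)
      * f (b r \<omega>))))
      = expectation (\<lambda>\<omega>. Z t \<omega> * f (b t \<omega>) - f spider_origin - X t \<omega> + integral {0..t} (\<lambda>r. W r \<omega>))"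
    by (intro Bochner_Integration.integral_cong path) auto
  also have "\<dots> = expectation (\<lambda>\<omega>. Z t \<omega> * f (b t \<omega>)) - f spider_origin"
    using mart t intW intZ EX EW by (simp add: is_martingale_def prob_space)
  finally show ?thesis
    by (simp add: Z_def)
qed

end

subsection \<open>Test functions on a leg\<close>

text \<open>A bump supported in [-1,1] with value 1 and slope 0 at 0. The third power makes it twice
  continuously differentiable at the endpoints.\<close>

definition cutoff :: "real \<Rightarrow> real" where
  "cutoff y = max 0 (1 - y\<^sup>2) ^ 3"

definition cutoff' :: "real \<Rightarrow> real" where
  "cutoff' y = - 6 * y * (max 0 (1 - y\<^sup>2))\<^sup>2"

definition cutoff'' :: "real \<Rightarrow> real" where
  "cutoff'' y = - 6 * (max 0 (1 - y\<^sup>2))\<^sup>2 + 24 * y\<^sup>2 * max 0 (1 - y\<^sup>2)"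

text \<open>Since the exponent is at least 2, the difference quotient at 0 is again a positive power
  of \<open>max 0 h\<close>, so the one-sided slopes agree.\<close>

lemma DERIV_max_0_power:
  fixes x :: real
  shows "((\<lambda>x. max 0 x ^ Suc (Suc k)) has_real_derivative real (Suc (Suc k))
      * max 0 x ^ Suc k) (at x)"
proof (cases "x = 0")
  case True
  have "((\<lambda>h. max 0 h ^ Suc k) \<longlongrightarrow> max 0 0 ^ Suc k) (at (0::real))"
    by (intro tendsto_intros)
  then have "((\<lambda>h. (max 0 (0 + h) ^ Suc (Suc k) - max 0 0 ^ Suc (Suc k)) / h) \<longlongrightarrow> max 0 0 ^ Suc k)
      (at (0::real))"
    by (rule Lim_transform_eventually) (auto simp: eventually_at_filter max_def)
  then show ?thesis
    by (simp add: True DERIV_def)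
next
  case False
  show ?thesis
  proof (cases "x > 0")
    case True
    have "((\<lambda>x. x ^ Suc (Suc k)) has_real_derivative real (Suc (Suc k)) * x ^ Suc k) (at x)"
      using DERIV_pow[of "Suc (Suc k)" x] by simp
    then have "((\<lambda>x. max 0 x ^ Suc (Suc k)) has_real_derivative real (Suc (Suc k))
        * x ^ Suc k) (at x)"
      by (rule has_field_derivative_transform_within_open[of _ _ _ "{0<..}"]) (use True in \<open>auto
          simp: max_def\<close>)
    then show ?thesis
      using True by (simp add: max_def)
  next
    case neg: False
    have "((\<lambda>x. max 0 x ^ Suc (Suc k)) has_real_derivative 0) (at x)"
      by (rule has_field_derivative_transform_within_open[of "\<lambda>_. 0" _ _ "{..<0}"])
        (use neg False in \<open>auto simp: max_def\<close>)
    then show ?thesis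
      using neg by (simp add: max_absorb1)
  qed
qed

lemma cutoff_deriv: "(cutoff has_real_derivative cutoff' y) (at y)"
proof -
  have "((\<lambda>y. 1 - y\<^sup>2) has_real_derivative - 2 * y) (at y)"
    by (auto intro!: derivative_eq_intros)
  from DERIV_chain2[OF DERIV_max_0_power[of 1] this]
  show ?thesis
    by (simp add: cutoff_def[abs_def] cutoff'_def eval_nat_numeral algebra_simps)
qed

lemma cutoff'_deriv: "(cutoff' has_real_derivative cutoff'' y) (at y)"
proof -
  have "((\<lambda>y. 1 - y\<^sup>2) has_real_derivative - 2 * y) (at y)"
    by (auto intro!: derivative_eq_intros)
  from DERIV_chain2[OF DERIV_max_0_power[of 0] this]
  have "((\<lambda>y. (max 0 (1 - y\<^sup>2))\<^sup>2) has_real_derivative - 4 * y * max 0 (1 - y\<^sup>2)) (at y)"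
    by (simp add: eval_nat_numeral algebra_simps)
  from DERIV_mult[OF DERIV_cmult[OF DERIV_ident, of "-6"] this]
  show ?thesis
    by (simp add: cutoff'_def[abs_def] cutoff''_def power2_eq_square algebra_simps)
qed

text \<open>The factor \<open>m\<close> vanishes when \<open>y\<close> lies outside [-1,1], so
  powers of \<open>y\<close> count only where they are at most 1. The constant 30 is 6 + 24.\<close>

lemma cutoff_bounds:
  "\<bar>cutoff y\<bar> \<le> 1" "\<bar>cutoff' y\<bar> \<le> 6" "\<bar>cutoff'' y\<bar> \<le> 30"
proof -
  define m where "m = max 0 (1 - y\<^sup>2)"
  have m: "0 \<le> m" "m \<le> 1"
    by (auto simp: m_def)
  have m2: "0 \<le> m\<^sup>2" "m\<^sup>2 \<le> 1"
    using m power_le_one[of m 2] by auto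
  have ym: "0 \<le> y\<^sup>2 * m" "y\<^sup>2 * m \<le> 1"
  proof -
    show "0 \<le> y\<^sup>2 * m" using m by simp
    show "y\<^sup>2 * m \<le> 1"
    proof (cases "y\<^sup>2 \<le> 1")
      case True
      then show ?thesis using m by (intro mult_le_one) auto
    qed (auto simp: m_def)
  qed
  have "\<bar>y\<bar> * m\<^sup>2 \<le> 1"
  proof (cases "y\<^sup>2 \<le> 1")
    case True
    then show ?thesis
      using m2 by (intro mult_le_one) (auto simp: abs_square_le_1)
  qed (auto simp: m_def)
  then show "\<bar>cutoff' y\<bar> \<le> 6"
    by (simp add: cutoff'_def abs_mult flip: m_def)
  show "\<bar>cutoff y\<bar> \<le> 1"
    using m power_le_one[of m 3] by (simp add: cutoff_def flip: m_def)
  show "\<bar>cutoff'' y\<bar> \<le> 30"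
    using m2 ym unfolding cutoff''_def m_def[symmetric] mult.assoc abs_le_iff by linarith
qed

text \<open>The rescaled function \<open>kink (m * x) / m\<^sup>2\<close> has vanishing value and slope at 0 and tends to 0
  uniformly, but its second derivative at 0 is always 1: it makes the second derivatives agree at
  the origin without changing the values or Kirchhoff's condition there.\<close>
definition kink :: "real \<Rightarrow> real" where
  "kink y = y\<^sup>2 / 2 * exp (- y)"

definition kink' :: "real \<Rightarrow> real" where
  "kink' y = (y - y\<^sup>2 / 2) * exp (- y)"

definition kink'' :: "real \<Rightarrow> real" where
  "kink'' y = (1 - 2 * y + y\<^sup>2 / 2) * exp (- y)"

lemma kink_deriv: "(kink has_real_derivative kink' y) (at y)"
  unfolding kink_def[abs_def] kink'_def
  by (auto intro!: derivative_eq_intros simp: field_simps power2_eq_square)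

lemma kink'_deriv: "(kink' has_real_derivative kink'' y) (at y)"
  unfolding kink'_def[abs_def] kink''_def
  by (auto intro!: derivative_eq_intros simp: field_simps power2_eq_square)

text \<open>Each polynomial factor is at most 4 times the quadratic Taylor polynomial of
  \<open>exp y\<close>, which lies below \<open>exp y\<close>.\<close>

lemma kink_bounds:
  assumes "0 \<le> y"
  shows "\<bar>kink y\<bar> \<le> 4" "\<bar>kink' y\<bar> \<le> 4" "\<bar>kink'' y\<bar> \<le> 4"
proof -
  have e: "1 + y + y\<^sup>2 / 2 \<le> exp y"
    using exp_lower_Taylor_quadratic[OF assms] .
  have "\<bar>P * exp (- y)\<bar> \<le> 4" if "\<bar>P\<bar> \<le> 4 * (1 + y + y\<^sup>2 / 2)" for P
  proof -
    have "\<bar>P\<bar> * exp (- y) \<le> (4 * exp y) * exp (- y)"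
      using that e by (intro mult_right_mono) auto
    also have "\<dots> = 4"
      by (simp add: exp_minus)
    finally have "\<bar>P\<bar> * exp (- y) \<le> 4" .
    then show ?thesis
      by (simp add: abs_mult)
  qed
  moreover have "\<bar>y\<^sup>2 / 2\<bar> \<le> 4 * (1 + y + y\<^sup>2 / 2)"
      "\<bar>y - y\<^sup>2 / 2\<bar> \<le> 4 * (1 + y + y\<^sup>2 / 2)" "\<bar>1 - 2 * y + y\<^sup>2 / 2\<bar> \<le> 4 * (1 + y + y\<^sup>2 / 2)"
    using assms zero_le_power2[of y] by (simp_all only: abs_le_iff) (auto simp: field_simps)
  ultimately show "\<bar>kink y\<bar> \<le> 4" "\<bar>kink' y\<bar> \<le> 4" "\<bar>kink'' y\<bar> \<le> 4"
    unfolding kink_def kink'_def kink''_def by blast+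
qed

lemma kink''_at_top: "(kink'' \<longlongrightarrow> 0) at_top"
  unfolding kink''_def[abs_def] by real_asymp

section \<open>Bounded solutions of the equation on one leg\<close>

definition leg_sol :: "real \<Rightarrow> real \<Rightarrow> real \<Rightarrow> real" where
  "leg_sol u \<rho> x = 1 / \<rho> + (u - 1 / \<rho>) * exp (- sqrt (2 * \<rho>) * x)"

definition leg_sol' :: "real \<Rightarrow> real \<Rightarrow> real \<Rightarrow> real" where
  "leg_sol' u \<rho> x = - sqrt (2 * \<rho>) * (u - 1 / \<rho>) * exp (- sqrt (2 * \<rho>) * x)"

text \<open>\<open>leg_sol\<close> is the bounded solution of
  \<open>w'' / 2 = \<rho> * w - 1\<close> on the half-line with \<open>w 0 = u\<close>; the growing
  exponential is absent. Its second derivative is written as the equation itself, so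
  \<open>leg_sol'_deriv\<close> verifies that equation.\<close>

definition leg_sol'' :: "real \<Rightarrow> real \<Rightarrow> real \<Rightarrow> real" where
  "leg_sol'' u \<rho> x = 2 * (\<rho> * leg_sol u \<rho> x - 1)"

lemma leg_sol_deriv: "(leg_sol u \<rho> has_real_derivative leg_sol' u \<rho> x) (at x)"
  unfolding leg_sol_def[abs_def] leg_sol'_def by (auto intro!: derivative_eq_intros)

lemma leg_sol'_deriv:
  assumes "0 < \<rho>"
  shows "(leg_sol' u \<rho> has_real_derivative leg_sol'' u \<rho> x) (at x)"
proof -
  have "sqrt (2 * \<rho>) * sqrt (2 * \<rho>) = 2 * \<rho>"
    using assms by simp
  then have "leg_sol'' u \<rho> x = (sqrt (2 * \<rho>) * sqrt (2 * \<rho>)) * ((u - 1 / \<rho>) * exp (- sqrt (2 * \<rho>)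
      * x))"
    using assms by (simp add: leg_sol''_def leg_sol_def distrib_left)
  then show ?thesis
    unfolding leg_sol'_def[abs_def] by (auto intro!: derivative_eq_intros)
qed

lemma leg_sol_bounds:
  assumes "0 < \<rho>"
  obtains A where "\<And>x. 0 \<le> x \<Longrightarrow> \<bar>leg_sol u \<rho> x\<bar> \<le> A" "\<And>x. 0 \<le> x \<Longrightarrow> \<bar>leg_sol' u \<rho> x\<bar> \<le> A"
    "\<And>x. 0 \<le> x \<Longrightarrow> \<bar>leg_sol'' u \<rho> x\<bar> \<le> A"
proof -
  define a where "a = 1 / \<rho> + \<bar>u - 1 / \<rho>\<bar>"
  define c where "c = sqrt (2 * \<rho>) * \<bar>u - 1 / \<rho>\<bar>"
  have pos: "0 \<le> a" "0 \<le> c"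
    using assms by (auto simp: a_def c_def)
  have e: "exp (- sqrt (2 * \<rho>) * x) \<le> 1" if "0 \<le> x" for x
    using that assms by simp
  have 1: "\<bar>leg_sol u \<rho> x\<bar> \<le> a" if "0 \<le> x" for x
  proof -
    have "\<bar>leg_sol u \<rho> x\<bar> \<le> \<bar>1 / \<rho>\<bar> + \<bar>(u - 1 / \<rho>) * exp (- sqrt (2 * \<rho>) * x)\<bar>"
      unfolding leg_sol_def by (rule abs_triangle_ineq)
    also have "\<dots> \<le> \<bar>1 / \<rho>\<bar> + \<bar>u - 1 / \<rho>\<bar> * 1"
      unfolding abs_mult using e[OF that] by (intro add_left_mono mult_left_mono) auto
    finally show ?thesis
      using assms by (simp add: a_def)
  qed
  have 2: "\<bar>leg_sol' u \<rho> x\<bar> \<le> c" if "0 \<le> x" for x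
  proof -
    have "\<bar>leg_sol' u \<rho> x\<bar> \<le> sqrt (2 * \<rho>) * \<bar>u - 1 / \<rho>\<bar> * 1"
      unfolding leg_sol'_def abs_mult using e[OF that] assms by (intro mult_mono) auto
    then show ?thesis by (simp add: c_def)
  qed
  have 3: "\<bar>leg_sol'' u \<rho> x\<bar> \<le> 2 * (\<rho> * a + 1)" if "0 \<le> x" for x
  proof -
    have "\<bar>\<rho> * leg_sol u \<rho> x\<bar> \<le> \<rho> * a"
      unfolding abs_mult using 1[OF that] assms by (simp add: mult_left_mono)
    moreover have "\<bar>2 * (y - 1)\<bar> \<le> 2 * (d + 1)" if "\<bar>y\<bar> \<le> d" for y d :: real
      using that unfolding abs_le_iff by auto
    ultimately show ?thesis
      unfolding leg_sol''_def by blast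
  qed
  have "0 \<le> \<rho> * a"
    using assms pos by simp
  show thesis
    by (rule that[of "a + c + 2 * (\<rho> * a + 1)"])
      (use 1 2 3 pos \<open>0 \<le> \<rho> * a\<close> in \<open>fastforce\<close>)+
qed

section \<open>Compactly supported approximations on one leg\<close>

definition leg_corr :: "real \<Rightarrow> real \<Rightarrow> real \<Rightarrow> real \<Rightarrow> real \<Rightarrow> real" where
  "leg_corr u l \<rho> m x = leg_sol u \<rho> x + 2 * (l - \<rho>) * u * (kink (m * x) / m\<^sup>2)"

definition leg_corr' :: "real \<Rightarrow> real \<Rightarrow> real \<Rightarrow> real \<Rightarrow> real \<Rightarrow> real" where
  "leg_corr' u l \<rho> m x = leg_sol' u \<rho> x + 2 * (l - \<rho>) * u * (kink' (m * x) / m)"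

text \<open>The second derivative of \<open>leg_sol\<close> at 0 is
  \<open>2 * (\<rho> * u - 1)\<close>. As \<open>kink'' 0 = 1\<close>, the coefficient of the
  correction turns this into \<open>2 * (l * u - 1)\<close>, the same for every
  \<open>\<rho>\<close>.\<close>

definition leg_corr'' :: "real \<Rightarrow> real \<Rightarrow> real \<Rightarrow> real \<Rightarrow> real \<Rightarrow> real" where
  "leg_corr'' u l \<rho> m x = leg_sol'' u \<rho> x + 2 * (l - \<rho>) * u * kink'' (m * x)"

text \<open>A single parameter \<open>m\<close> widens the cut-off and shrinks the correction at the
  same time, so one limit removes both.\<close>

definition leg_test :: "real \<Rightarrow> real \<Rightarrow> real \<Rightarrow> real \<Rightarrow> real \<Rightarrow> real" where
  "leg_test u l \<rho> m x = cutoff (x / m) * leg_corr u l \<rho> m x"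

definition leg_test' :: "real \<Rightarrow> real \<Rightarrow> real \<Rightarrow> real \<Rightarrow> real \<Rightarrow> real" where
  "leg_test' u l \<rho> m x = cutoff' (x / m) / m * leg_corr u l \<rho> m x
      + cutoff (x / m) * leg_corr' u l \<rho> m x"

definition leg_test'' :: "real \<Rightarrow> real \<Rightarrow> real \<Rightarrow> real \<Rightarrow> real \<Rightarrow> real" where
  "leg_test'' u l \<rho> m x = cutoff'' (x / m) / m\<^sup>2 * leg_corr u l \<rho> m x
     + 2 * (cutoff' (x / m) / m) * leg_corr' u l \<rho> m x + cutoff (x / m) * leg_corr'' u l \<rho> m x"

lemma leg_corr_deriv:
  assumes "0 < m"
  shows "(leg_corr u l \<rho> m has_real_derivative leg_corr' u l \<rho> m x) (at x)"
  unfolding leg_corr_def[abs_def] leg_corr'_def using assms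
  by (auto intro!: derivative_eq_intros leg_sol_deriv DERIV_chain2[OF kink_deriv]
      simp: power2_eq_square)

lemma leg_corr'_deriv:
  assumes "0 < m" "0 < \<rho>"
  shows "(leg_corr' u l \<rho> m has_real_derivative leg_corr'' u l \<rho> m x) (at x)"
  unfolding leg_corr'_def[abs_def] leg_corr''_def using assms
  by (auto intro!: derivative_eq_intros leg_sol'_deriv DERIV_chain2[OF kink'_deriv])

lemma leg_test_deriv:
  assumes "0 < m"
  shows "(leg_test u l \<rho> m has_real_derivative leg_test' u l \<rho> m x) (at x)"
  unfolding leg_test_def[abs_def] leg_test'_def using assms
  by (auto intro!: derivative_eq_intros leg_corr_deriv DERIV_chain2[OF cutoff_deriv])

lemma leg_test'_deriv:
  assumes "0 < m" "0 < \<rho>"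
  shows "(leg_test' u l \<rho> m has_real_derivative leg_test'' u l \<rho> m x) (at x)"
  unfolding leg_test'_def[abs_def] leg_test''_def using assms
  by (auto intro!: derivative_eq_intros leg_corr_deriv leg_corr'_deriv
      DERIV_chain2[OF cutoff_deriv] DERIV_chain2[OF cutoff'_deriv]
      simp: power2_eq_square field_simps)

lemma leg_test''_continuous:
  assumes "0 < m" "0 < \<rho>"
  shows "continuous_on S (leg_test'' u l \<rho> m)"
  unfolding leg_test''_def[abs_def] leg_corr''_def leg_corr'_def leg_corr_def
    leg_sol''_def leg_sol'_def leg_sol_def kink''_def kink'_def kink_def
    cutoff_def cutoff'_def cutoff''_def
  using assms by (intro continuous_intros) auto

lemma C2c_leg_test:
  assumes "0 < m" "0 < \<rho>"
  shows "C2c_half_line (leg_test u l \<rho> m) (leg_test' u l \<rho> m) (leg_test'' u l \<rho> m)"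
  unfolding C2c_half_line_def
proof (intro conjI allI impI)
  show "\<exists>R. \<forall>x\<ge>R. leg_test u l \<rho> m x = 0"
  proof (intro exI[of _ m] allI impI)
    fix x assume "m \<le> x"
    then have "1 \<le> (x / m)\<^sup>2"
      using assms by (simp add: one_le_power)
    then show "leg_test u l \<rho> m x = 0"
      by (simp add: leg_test_def cutoff_def)
  qed
qed (use assms in \<open>auto intro: has_field_derivative_at_within leg_test_deriv leg_test'_deriv
    leg_test''_continuous\<close>)

text \<open>These values enter the gluing conditions: the slope is that of \<open>leg_sol\<close>,
  and the second derivative is free of \<open>\<rho>\<close>. The term with \<open>m\<^sup>2\<close>
  comes from \<open>cutoff'' 0 = - 6\<close>.\<close>

lemma leg_test_at_0:
  assumes "0 < m"
  shows "leg_test u l \<rho> m 0 = u" "leg_test' u l \<rho> m 0 = - sqrt (2 * \<rho>) * (u - 1 / \<rho>)"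
    "0 < \<rho> \<Longrightarrow> leg_test'' u l \<rho> m 0 = 2 * (l * u - 1) - 6 * u / m\<^sup>2"
  by (simp_all add: leg_test_def leg_test'_def leg_test''_def leg_corr_def leg_corr'_def
      leg_corr''_def leg_sol_def leg_sol'_def leg_sol''_def kink_def kink'_def kink''_def
      cutoff_def cutoff'_def cutoff''_def algebra_simps)

text \<open>The bounds are uniform in \<open>m\<close>, which is what dominated convergence will
  need.\<close>

lemma leg_test_bounds:
  assumes "0 < \<rho>"
  obtains B where "\<And>m x. 1 \<le> m \<Longrightarrow> 0 \<le> x \<Longrightarrow> \<bar>leg_test u l \<rho> m x\<bar> \<le> B"
    "\<And>m x. 1 \<le> m \<Longrightarrow> 0 \<le> x \<Longrightarrow> \<bar>leg_test'' u l \<rho> m x\<bar> \<le> B"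
proof -
  obtain A where A: "\<And>x. 0 \<le> x \<Longrightarrow> \<bar>leg_sol u \<rho> x\<bar> \<le> A" "\<And>x. 0 \<le> x \<Longrightarrow> \<bar>leg_sol' u \<rho> x\<bar> \<le> A"
    "\<And>x. 0 \<le> x \<Longrightarrow> \<bar>leg_sol'' u \<rho> x\<bar> \<le> A"
    using leg_sol_bounds[OF assms] by metis
  define k where "k = 2 * (l - \<rho>) * u"
  define D where "D = A + \<bar>k\<bar> * 4"
  have D0: "0 \<le> D"
    using A(1)[of 0] by (auto simp: D_def)
  have scale: "\<bar>y / d\<bar> \<le> C" if "1 \<le> d" "\<bar>y\<bar> \<le> C" for y d C :: real
  proof -
    have "\<bar>y\<bar> / \<bar>d\<bar> \<le> \<bar>y\<bar> / 1"
      using that by (intro divide_left_mono) auto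
    then show ?thesis
      using that by simp
  qed
  have add: "\<bar>a + k * y\<bar> \<le> D" if "\<bar>a\<bar> \<le> A" "\<bar>y\<bar> \<le> 4" for a y
  proof -
    have "\<bar>k * y\<bar> \<le> \<bar>k\<bar> * 4"
      unfolding abs_mult using that by (intro mult_left_mono) auto
    then show ?thesis
      using that unfolding D_def by linarith
  qed
  have corr: "\<bar>leg_corr u l \<rho> m x\<bar> \<le> D" "\<bar>leg_corr' u l \<rho> m x\<bar> \<le> D" "\<bar>leg_corr'' u l \<rho> m x\<bar> \<le> D"
    if "1 \<le> m" "0 \<le> x" for m x
    unfolding leg_corr_def leg_corr'_def leg_corr''_def k_def[symmetric]
    using that by (intro add A scale kink_bounds one_le_power; simp)+
  show thesis
  \<comment> \<open>The product rule for the second derivative contributes 30 + 2 * 6 + 1 = 43 times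
    the common bound \<open>D\<close> on the corrected solution and its derivatives.\<close>
  proof (rule that[of "43 * D"])
    fix m x :: real assume m: "1 \<le> m" and x: "0 \<le> x"
    have m2: "1 \<le> m\<^sup>2"
      using m by (rule one_le_power)
    have p1: "\<bar>cutoff (x / m) * y\<bar> \<le> 1 * D" if "\<bar>y\<bar> \<le> D" for y
      unfolding abs_mult using that cutoff_bounds(1) by (intro mult_mono) auto
    have p2: "\<bar>cutoff' (x / m) / m * y\<bar> \<le> 6 * D" if "\<bar>y\<bar> \<le> D" for y
      unfolding abs_mult[of "cutoff' (x / m) / m"]
      using that scale[OF m cutoff_bounds(2)] by (intro mult_mono) auto
    have p3: "\<bar>cutoff'' (x / m) / m\<^sup>2 * y\<bar> \<le> 30 * D" if "\<bar>y\<bar> \<le> D" for y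
      unfolding abs_mult[of "cutoff'' (x / m) / m\<^sup>2"]
      using that scale[OF m2 cutoff_bounds(3)] by (intro mult_mono) auto
    show "\<bar>leg_test u l \<rho> m x\<bar> \<le> 43 * D"
      using p1[OF corr(1)[OF m x]] D0 unfolding leg_test_def by linarith
    show "\<bar>leg_test'' u l \<rho> m x\<bar> \<le> 43 * D"
      using p3[OF corr(1)[OF m x]] p2[OF corr(2)[OF m x]] p1[OF corr(3)[OF m x]]
      unfolding leg_test''_def mult.assoc by linarith
  qed
qed

text \<open>Away from 0, \<open>kink'' (m * x)\<close> decays as \<open>m\<close> grows. At
  \<open>x = 0\<close> it stays 1, and the second derivative tends to \<open>2 * (l * u - 1)\<close>
  instead.\<close>

lemma leg_test_limits:
  assumes m: "filterlim m at_top sequentially" and x: "0 < x"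
  shows "(\<lambda>n. leg_test u l \<rho> (m n) x) \<longlonglongrightarrow> leg_sol u \<rho> x"
    and "(\<lambda>n. leg_test'' u l \<rho> (m n) x) \<longlonglongrightarrow> leg_sol'' u \<rho> x"
proof -
  have mx: "filterlim (\<lambda>n. m n * x) at_top sequentially"
    using filterlim_tendsto_pos_mult_at_top[OF tendsto_const x m] by (simp add: mult.commute)
  have xm: "(\<lambda>n. x / m n) \<longlonglongrightarrow> 0"
    using m by (intro real_tendsto_divide_at_top[of _ x]) auto
  have bdd: "(\<lambda>n. y n / d n) \<longlonglongrightarrow> 0"
    if "\<And>n. \<bar>y n\<bar> \<le> C" "filterlim d at_top sequentially" for y d :: "nat \<Rightarrow> real" and C
  proof (rule tendsto_rabs_zero_cancel,
      rule tendsto_sandwich[where f="\<lambda>_. 0" and h="\<lambda>n. C / \<bar>d n\<bar>"])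
    show "(\<lambda>n. C / \<bar>d n\<bar>) \<longlonglongrightarrow> 0"
      using that(2) by (intro real_tendsto_divide_at_top[of _ C] tendsto_const)
        (auto intro: filterlim_compose[OF filterlim_abs_real])
  qed (use that(1) in \<open>auto intro!: always_eventually divide_right_mono\<close>)
  have m2: "filterlim (\<lambda>n. (m n)\<^sup>2) at_top sequentially"
    using m by (intro filterlim_pow_at_top) auto
  have ev: "\<forall>\<^sub>F n in sequentially. 0 \<le> m n"
    using m by (simp add: filterlim_at_top)
  \<comment> \<open>\<open>kink_bounds\<close> needs a nonnegative argument, while
    \<open>m n\<close> is nonnegative only eventually; hence the detour through
    \<open>max 0 (m n)\<close>.\<close>
  have k0: "(\<lambda>n. kink (m n * x) / (m n)\<^sup>2) \<longlonglongrightarrow> 0"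
  proof (rule Lim_transform_eventually[OF bdd[of "\<lambda>n. kink (max 0 (m n) * x)" 4, OF _ m2]])
    show "\<bar>kink (max 0 (m n) * x)\<bar> \<le> 4" for n
      using x by (intro kink_bounds) auto
  qed (use ev in \<open>auto elim: eventually_mono simp: max_def\<close>)
  have k1: "(\<lambda>n. kink' (m n * x) / m n) \<longlonglongrightarrow> 0"
  proof (rule Lim_transform_eventually[OF bdd[of "\<lambda>n. kink' (max 0 (m n) * x)" 4, OF _ m]])
    show "\<bar>kink' (max 0 (m n) * x)\<bar> \<le> 4" for n
      using x by (intro kink_bounds) auto
  qed (use ev in \<open>auto elim: eventually_mono simp: max_def\<close>)
  have k2: "(\<lambda>n. kink'' (m n * x)) \<longlonglongrightarrow> 0"
    by (rule filterlim_compose[OF kink''_at_top mx])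
  have c0: "(\<lambda>n. cutoff (x / m n)) \<longlonglongrightarrow> 1"
  proof -
    have "(\<lambda>n. cutoff (x / m n)) \<longlonglongrightarrow> cutoff 0"
      by (rule isCont_tendsto_compose[OF DERIV_isCont[OF cutoff_deriv] xm])
    then show ?thesis by (simp add: cutoff_def)
  qed
  have c1: "(\<lambda>n. cutoff' (x / m n) / m n) \<longlonglongrightarrow> 0"
    by (rule bdd[OF cutoff_bounds(2) m])
  have c2: "(\<lambda>n. cutoff'' (x / m n) / (m n)\<^sup>2) \<longlonglongrightarrow> 0"
    by (rule bdd[OF cutoff_bounds(3) m2])
  show "(\<lambda>n. leg_test u l \<rho> (m n) x) \<longlonglongrightarrow> leg_sol u \<rho> x"
    unfolding leg_test_def leg_corr_def
    by (rule tendsto_eq_intros c0 k0 refl)+ simp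
  show "(\<lambda>n. leg_test'' u l \<rho> (m n) x) \<longlonglongrightarrow> leg_sol'' u \<rho> x"
    unfolding leg_test''_def leg_corr_def leg_corr'_def leg_corr''_def
    by (rule tendsto_eq_intros c0 c1 c2 k0 k1 k2 refl)+ simp
qed

subsection \<open>Occupation times\<close>

text \<open>A continuous approximation from below of the indicator of leg \<open>i\<close> without
  the origin.\<close>

definition leg_ramp :: "real \<Rightarrow> nat \<Rightarrow> nat \<times> real \<Rightarrow> real" where
  "leg_ramp m i p = min 1 (m * spider_coord i p)"

lemma spider_coord_leg_pt: "i \<ge> 1 \<Longrightarrow> spider_coord i (leg_pt j x) = (if j = i then x else 0)"
  by (auto simp: spider_coord_def leg_pt_def spider_origin_def)

lemma spider_continuous_leg_ramp:
  assumes "i \<ge> 1"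
  shows "spider_continuous N (leg_ramp m i)"
  unfolding spider_continuous_def leg_ramp_def
proof
  fix j
  show "continuous_on {0..} (\<lambda>x. min 1 (m * spider_coord i (leg_pt j x)))"
    by (cases "j = i") (use assms in \<open>auto simp: spider_coord_leg_pt intro!: continuous_intros\<close>)
qed

lemma leg_ramp_bounds:
  assumes "p \<in> spider_pts N" "0 \<le> m"
  shows "0 \<le> leg_ramp m i p" "leg_ramp m i p \<le> (if fst p = i then 1 else 0)"
  using assms spider_coord_nonneg[OF assms(1), of i] by (auto simp: leg_ramp_def spider_coord_def)

lemma leg_ramp_tendsto:
  assumes "p \<in> spider_pts N" "i \<ge> 1" "filterlim m at_top sequentially"
  shows "(\<lambda>n. leg_ramp (m n) i p) \<longlonglongrightarrow> (if fst p = i then 1 else 0)"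
proof (cases "fst p = i")
  case True
  then have pos: "0 < snd p"
    using assms(1,2) by (auto simp: spider_pts_def spider_origin_def)
  have "\<forall>\<^sub>F n in sequentially. 1 / snd p \<le> m n"
    using assms(3) by (simp add: filterlim_at_top)
  then have "\<forall>\<^sub>F n in sequentially. leg_ramp (m n) i p = 1"
    by eventually_elim (use True pos in \<open>auto simp: leg_ramp_def spider_coord_def field_simps\<close>)
  then show ?thesis
    using True by (simp add: tendsto_eventually)
qed (simp add: leg_ramp_def spider_coord_def)

lemma filterlim_real_Suc: "filterlim (\<lambda>n. real (Suc n)) at_top sequentially"
  by (rule filterlim_compose[OF filterlim_real_sequentially filterlim_Suc])

context kirchhoff_spider
begin

text \<open>The indicator of a leg is not continuous along paths. Dominated convergence from the
  ramps gives both its integrability and the limit that later yields measurability.\<close>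

lemma leg_indicator_integral:
  assumes \<omega>: "\<omega> \<in> space M" and i: "i \<ge> 1"
  shows "(\<lambda>s. if fst (b s \<omega>) = i then 1 else 0 :: real) integrable_on {0..t}"
    and "(\<lambda>n. time_integral (leg_ramp (real (Suc n)) i) t \<omega>)
      \<longlonglongrightarrow> integral {0..t} (\<lambda>s. if fst (b s \<omega>) = i then 1 else 0)"
proof -
  have 1: "(\<lambda>s. leg_ramp (real (Suc n)) i (b s \<omega>)) integrable_on {0..t}" for n
    by (intro integrable_continuous_real spider_continuous_path_upto spider_continuous_leg_ramp \<omega> i)
  have 2: "norm (leg_ramp (real (Suc n)) i (b s \<omega>)) \<le> 1" if "s \<in> {0..t}" for n s
    using leg_ramp_bounds[OF b_pts[OF \<omega>], of s "real (Suc n)" i] that by (auto split: if_splits)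
  have 3: "(\<lambda>n. leg_ramp (real (Suc n)) i (b s \<omega>)) \<longlonglongrightarrow> (if fst (b s \<omega>) = i then 1 else 0)"
    if "s \<in> {0..t}" for s
    using that by (intro leg_ramp_tendsto[OF b_pts] \<omega> i filterlim_real_Suc) auto
  show "(\<lambda>s. if fst (b s \<omega>) = i then 1 else 0 :: real) integrable_on {0..t}"
    by (rule dominated_convergence(1)[OF 1 _ 2 3]) auto
  show "(\<lambda>n. time_integral (leg_ramp (real (Suc n)) i) t \<omega>)
      \<longlonglongrightarrow> integral {0..t} (\<lambda>s. if fst (b s \<omega>) = i then 1 else 0)"
    unfolding time_integral_def
    by (rule dominated_convergence(2)[OF 1 _ 2 3]) auto
qed

lemma occ_time_eq_integral:
  assumes "\<omega> \<in> space M"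
  shows "(\<lambda>s. if fst (b s \<omega>) \<in> {1..N0} then 1 else 0 :: real) integrable_on {0..t}"
    and "occ_time N0 b t \<omega> = integral {0..t} (\<lambda>s. if fst (b s \<omega>) \<in> {1..N0} then 1 else 0)"
proof -
  have eq: "(\<Sum>i=1..N0. if fst (b s \<omega>) = i then 1 else 0 :: real)
      = (if fst (b s \<omega>) \<in> {1..N0} then 1 else 0)" for s
    by simp
  have int: "(\<lambda>s. if fst (b s \<omega>) = i then 1 else 0 :: real) integrable_on {0..t}"
      if "i \<in> {1..N0}" for i
    using that by (intro leg_indicator_integral assms) auto
  have "(\<lambda>s. \<Sum>i=1..N0. if fst (b s \<omega>) = i then 1 else 0 :: real) integrable_on {0..t}"
    by (intro integrable_sum int) auto
  then show "(\<lambda>s. if fst (b s \<omega>) \<in> {1..N0} then 1 else 0 :: real) integrable_on {0..t}"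
    unfolding eq .
  have "occ_time N0 b t \<omega> = integral {0..t} (\<lambda>s. \<Sum>i=1..N0. if fst (b s \<omega>) = i then 1 else 0)"
    unfolding occ_time_def by (rule integral_sum[symmetric]) (auto intro: int)
  then show "occ_time N0 b t \<omega> = integral {0..t} (\<lambda>s. if fst (b s \<omega>) \<in> {1..N0} then 1 else 0)"
    unfolding eq .
qed

text \<open>The increment is the integral of an indicator over \<open>{s..t}\<close>. The two bounds
  make the occupation time 1-Lipschitz in time.\<close>

lemma occ_time_diff:
  assumes \<omega>: "\<omega> \<in> space M" and s: "0 \<le> s" "s \<le> t"
  shows "0 \<le> occ_time N0 b t \<omega> - occ_time N0 b s \<omega>" "occ_time N0 b t \<omega> - occ_time N0 b s \<omega> \<le> t - s"
proof -
  let ?h = "\<lambda>s. if fst (b s \<omega>) \<in> {1..N0} then 1 else 0 :: real"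
  note int = occ_time_eq_integral(1)[OF \<omega>, of N0 t]
  have int': "?h integrable_on {s..t}"
    by (rule integrable_on_subinterval[OF int]) (use s in auto)
  have "integral {0..s} ?h + integral {s..t} ?h = integral {0..t} ?h"
    by (rule Henstock_Kurzweil_Integration.integral_combine[OF s int])
  then have eq: "occ_time N0 b t \<omega> - occ_time N0 b s \<omega> = integral {s..t} ?h"
    by (simp add: occ_time_eq_integral(2)[OF \<omega>])
  show "0 \<le> occ_time N0 b t \<omega> - occ_time N0 b s \<omega>"
    unfolding eq by (rule integral_nonneg[OF int']) auto
  have "integral {s..t} ?h \<le> integral {s..t} (\<lambda>_. 1)"
    by (rule integral_le[OF int']) auto
  then show "occ_time N0 b t \<omega> - occ_time N0 b s \<omega> \<le> t - s"
    unfolding eq using s by simp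
qed

lemma occ_time_bounds:
  assumes "\<omega> \<in> space M" "0 \<le> t"
  shows "0 \<le> occ_time N0 b t \<omega>" "occ_time N0 b t \<omega> \<le> t"
  using occ_time_diff[OF assms(1) order_refl assms(2), of N0] by (auto simp: occ_time_def)

lemma occ_time_continuous:
  assumes \<omega>: "\<omega> \<in> space M"
  shows "continuous_on {0..} (\<lambda>t. occ_time N0 b t \<omega>)"
proof (rule continuous_on_subset)
  have "1-lipschitz_on {0..} (\<lambda>t. occ_time N0 b t \<omega>)"
  proof (rule lipschitz_onI)
    fix x y :: real assume "x \<in> {0..}" "y \<in> {0..}"
    then show "dist (occ_time N0 b x \<omega>) (occ_time N0 b y \<omega>) \<le> 1 * dist x y"
      using occ_time_diff[OF \<omega>, of x y N0] occ_time_diff[OF \<omega>, of y x N0]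
      by (cases "x \<le> y") (auto simp: dist_real_def)
  qed simp
  then show "continuous_on {0..} (\<lambda>t. occ_time N0 b t \<omega>)"
    by (rule lipschitz_on_continuous_on)
qed simp

lemma occ_time_tendsto:
  assumes "\<omega> \<in> space M"
  shows "(\<lambda>n. \<Sum>i=1..N0. time_integral (leg_ramp (real (Suc n)) i) t \<omega>) \<longlonglongrightarrow> occ_time N0 b t \<omega>"
  unfolding occ_time_def by (intro tendsto_sum leg_indicator_integral assms) auto

lemma occ_time_measurable:
  assumes "0 \<le> t"
  shows "occ_time N0 b t \<in> borel_measurable M"
proof (rule borel_measurable_LIMSEQ_real[OF occ_time_tendsto])
  show "(\<lambda>\<omega>. \<Sum>i=1..N0. time_integral (leg_ramp (real (Suc n)) i) t \<omega>) \<in> borel_measurable M" for n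
    using assms by (intro borel_measurable_sum Filt_measurable[OF time_integral_measurable_Filt]
        spider_continuous_leg_ramp) auto
qed

end

section \<open>The resolvent equation with two rates\<close>

locale kirchhoff_occupation = kirchhoff_spider +
  fixes N0 :: nat and l \<beta> :: real
  assumes N0_le: "N0 \<le> N" and l_pos: "0 < l" and sum_pos: "0 < l + \<beta>"
begin

definition rate :: "nat \<Rightarrow> real" where
  "rate i = (if i \<in> {1..N0} then l + \<beta> else l)"

text \<open>The common value at the origin for which the slopes of the leg solutions sum to 0; it
  solves the linear equation of \<open>u0_kirchhoff\<close>.\<close>

definition u0 :: real where
  "u0 = (real N0 / sqrt (l + \<beta>) + real (N - N0) / sqrt l)
      / (real N0 * sqrt (l + \<beta>) + real (N - N0) * sqrt l)"

lemma rate_pos: "0 < rate i"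
  using l_pos sum_pos by (simp add: rate_def)

lemma sum_rate: "(\<Sum>i=1..N. g (rate i))
    = real N0 * g (l + \<beta>) + real (N - N0) * g l" for g :: "real \<Rightarrow> real"
proof -
  have "{1..N} = {1..N0} \<union> {Suc N0..N}" "{1..N0} \<inter> {Suc N0..N} = {}"
    using N0_le by auto
  then have "(\<Sum>i=1..N. g (rate i)) = (\<Sum>i=1..N0. g (rate i)) + (\<Sum>i=Suc N0..N. g (rate i))"
    by (metis finite_atLeastAtMost sum.union_disjoint)
  also have "(\<Sum>i=1..N0. g (rate i)) = (\<Sum>i=1..N0. g (l + \<beta>))"
    by (intro sum.cong) (auto simp: rate_def)
  also have "(\<Sum>i=Suc N0..N. g (rate i)) = (\<Sum>i=Suc N0..N. g l)"
    by (intro sum.cong) (auto simp: rate_def)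
  finally show ?thesis
    by simp
qed

lemma u0_kirchhoff: "(\<Sum>i=1..N. - sqrt (2 * rate i) * (u0 - 1 / rate i)) = 0"
proof -
  define D where "D = real N0 * sqrt (l + \<beta>) + real (N - N0) * sqrt l"
  have "D > 0"
  proof (cases "N0 = 0")
    case True
    then show ?thesis
      using legs l_pos by (simp add: D_def)
  next
    case False
    then show ?thesis
      using sum_pos l_pos unfolding D_def by (intro add_pos_nonneg) auto
  qed
  then have "u0 * D = real N0 / sqrt (l + \<beta>) + real (N - N0) / sqrt l"
    by (simp add: u0_def D_def)
  moreover have "sqrt x * (1 / x) = 1 / sqrt x" if "0 < x" for x
    using that by (simp add: real_div_sqrt field_simps)
  ultimately have *: "real N0 * (sqrt (l + \<beta>) * (u0 - 1 / (l + \<beta>)))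
      + real (N - N0) * (sqrt l * (u0 - 1 / l)) = 0"
    using l_pos sum_pos by (simp add: D_def right_diff_distrib algebra_simps)
  have "(\<Sum>i=1..N. - sqrt (2 * rate i) * (u0 - 1 / rate i))
      = - sqrt 2 * (\<Sum>i=1..N. sqrt (rate i) * (u0 - 1 / rate i))"
    by (simp add: sum_distrib_left real_sqrt_mult algebra_simps)
  also have "\<dots> = 0"
    by (simp only: sum_rate[of "\<lambda>r. sqrt r * (u0 - 1 / r)"] * mult_zero_right)
  finally show ?thesis .
qed

definition test :: "real \<Rightarrow> nat \<times> real \<Rightarrow> real" where
  "test m p = leg_test u0 l (rate (fst p)) m (snd p)"

text \<open>At \<open>x = 0\<close> the encoding replaces the leg number by 0 and may change the
  rate, but \<open>leg_test\<close> has the value \<open>u0\<close> there for every rate.\<close>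

lemma test_leg_pt: "0 < m \<Longrightarrow> test m (leg_pt i x) = leg_test u0 l (rate i) m x"
  by (simp add: test_def leg_pt_def spider_origin_def leg_test_at_0)

lemma test_origin: "0 < m \<Longrightarrow> test m spider_origin = u0"
  by (simp add: test_def spider_origin_def leg_test_at_0)

text \<open>The three gluing requirements meet here: the cut-off gives compact support, the kink
  correction equal second derivatives at 0, and the choice of \<open>u0\<close> Kirchhoff's
  condition.\<close>

lemma test_dom:
  assumes "0 < m"
  shows "kirchhoff_dom N (test m) (\<lambda>i. leg_test' u0 l (rate i) m) (\<lambda>i. leg_test'' u0 l (rate i) m)"
  using assms u0_kirchhoff
  by (simp add: kirchhoff_dom_def test_leg_pt C2c_leg_test rate_pos leg_test_at_0)

lemma test_bounds:
  obtains B where "\<And>m p. 1 \<le> m \<Longrightarrow> p \<in> spider_pts N \<Longrightarrow> \<bar>test m p\<bar> \<le> B"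
    "\<And>m p. 1 \<le> m \<Longrightarrow> p \<in> spider_pts N \<Longrightarrow> \<bar>spider_gen (\<lambda>i. leg_test'' u0 l (rate i) m) p\<bar> \<le> B"
proof -
  obtain B1 where B1: "\<And>m x. 1 \<le> m \<Longrightarrow> 0 \<le> x \<Longrightarrow> \<bar>leg_test u0 l (l + \<beta>) m x\<bar> \<le> B1"
    "\<And>m x. 1 \<le> m \<Longrightarrow> 0 \<le> x \<Longrightarrow> \<bar>leg_test'' u0 l (l + \<beta>) m x\<bar> \<le> B1"
    using leg_test_bounds[OF sum_pos] by metis
  obtain B2 where B2: "\<And>m x. 1 \<le> m \<Longrightarrow> 0 \<le> x \<Longrightarrow> \<bar>leg_test u0 l l m x\<bar> \<le> B2"
    "\<And>m x. 1 \<le> m \<Longrightarrow> 0 \<le> x \<Longrightarrow> \<bar>leg_test'' u0 l l m x\<bar> \<le> B2"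
    using leg_test_bounds[OF l_pos] by metis
  have 1: "\<bar>leg_test u0 l (rate i) m x\<bar> \<le> max B1 B2" if "1 \<le> m" "0 \<le> x" for i m x
    using B1(1)[OF that] B2(1)[OF that] by (auto simp: rate_def)
  have 2: "\<bar>leg_test'' u0 l (rate i) m x / 2\<bar> \<le> max B1 B2" if "1 \<le> m" "0 \<le> x" for i m x
    using B1(2)[OF that] B2(2)[OF that] by (auto simp: rate_def)
  have nn: "0 \<le> snd p" if "p \<in> spider_pts N" for p
    using that by (auto simp: spider_pts_def spider_origin_def)
  show thesis
  proof (rule that[of "max B1 B2"])
    fix m :: real and p :: "nat \<times> real" assume m: "1 \<le> m" and p: "p \<in> spider_pts N"
    show "\<bar>test m p\<bar> \<le> max B1 B2"
      unfolding test_def by (rule 1[OF m nn[OF p]])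
    show "\<bar>spider_gen (\<lambda>i. leg_test'' u0 l (rate i) m) p\<bar> \<le> max B1 B2"
      unfolding spider_gen_def using 2[OF m nn[OF p]] 2[OF m order_refl] by simp
  qed
qed

definition sol :: "nat \<times> real \<Rightarrow> real" where
  "sol p = leg_sol u0 (rate (fst p)) (snd p)"

lemma test_tendsto:
  assumes "p \<in> spider_pts N"
  shows "(\<lambda>n. test (real (Suc n)) p) \<longlonglongrightarrow> sol p"
  using assms
proof (cases rule: spider_pts_cases)
  case 1
  then have "test (real (Suc n)) p = sol p" for n
    using test_origin[of "real (Suc n)"] by (simp add: sol_def leg_sol_def spider_origin_def)
  then show ?thesis
    by simp
next
  case (2 i x)
  then show ?thesis
    using leg_test_limits(1)[OF filterlim_real_Suc] by (simp add: test_def sol_def)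
qed

text \<open>At the origin the generator is evaluated with the rate of the unmarked legs, in agreement
  with the convention that the origin does not count as a marked leg. Therefore the time spent
  at the origin plays no role.\<close>
lemma test_gen_tendsto:
  assumes "p \<in> spider_pts N"
  shows "(\<lambda>n. spider_gen (\<lambda>i. leg_test'' u0 l (rate i) (real (Suc n))) p)
      \<longlonglongrightarrow> rate (fst p) * sol p - 1"
  using assms
proof (cases rule: spider_pts_cases)
  case 1
  have "(\<lambda>n. (2 * (l * u0 - 1) - 6 * u0 / (real (Suc n))\<^sup>2) / 2) \<longlonglongrightarrow> (2 * (l * u0 - 1) - 0) / 2"
    by (intro tendsto_intros real_tendsto_divide_at_top[of _ "6 * u0"]
        filterlim_pow_at_top filterlim_real_Suc) auto
  then have "(\<lambda>n. (2 * (l * u0 - 1) - 6 * u0 / (real (Suc n))\<^sup>2) / 2) \<longlonglongrightarrow> l * u0 - 1"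
    by (simp del: of_nat_Suc add: diff_divide_distrib)
  then show ?thesis
    using 1 by (simp add: diff_divide_distrib spider_gen_def spider_origin_def leg_test_at_0
        rate_pos sol_def leg_sol_def
        rate_def[of 0] del: of_nat_Suc)
next
  case (2 i x)
  have "(\<lambda>n. leg_test'' u0 l (rate i) (real (Suc n)) x / 2) \<longlonglongrightarrow> leg_sol'' u0 (rate i) x / 2"
    using 2 by (intro tendsto_intros leg_test_limits(2)[OF filterlim_real_Suc]) auto
  then show ?thesis
    using 2 by (simp add: spider_gen_def sol_def leg_sol''_def diff_divide_distrib)
qed

definition potential :: "real \<Rightarrow> nat \<times> real \<Rightarrow> real" where
  "potential m p = l + \<beta> * (\<Sum>i=1..N0. leg_ramp m i p)"

lemma potential_continuous: "spider_continuous N (potential m)"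
  using spider_continuous_leg_ramp[of _ N m]
  unfolding spider_continuous_def potential_def by (auto intro!: continuous_intros)

lemma potential_tendsto:
  assumes "p \<in> spider_pts N"
  shows "(\<lambda>n. potential (real (Suc n)) p) \<longlonglongrightarrow> rate (fst p)"
proof -
  have "(\<lambda>n. potential (real (Suc n)) p) \<longlonglongrightarrow> l + \<beta> * (\<Sum>i=1..N0. if fst p = i then 1 else 0)"
    unfolding potential_def by (intro tendsto_intros leg_ramp_tendsto[OF assms]
        filterlim_real_Suc) auto
  moreover have "l + \<beta> * (\<Sum>i=1..N0. if fst p = i then 1 else 0) = rate (fst p)"
    by (simp add: rate_def)
  ultimately show ?thesis
    by simp
qed

text \<open>At most one ramp is nonzero at any point, so the sum of ramps lies in [0,1]. For
  negative \<open>\<beta>\<close>, positivity of \<open>l + \<beta>\<close> keeps the potential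
  nonnegative.\<close>

lemma potential_bounds:
  assumes p: "p \<in> spider_pts N" and m: "0 \<le> m"
  shows "0 \<le> potential m p" "potential m p \<le> l + \<bar>\<beta>\<bar>"
proof -
  define S where "S = (\<Sum>i=1..N0. leg_ramp m i p)"
  have "S \<le> (\<Sum>i=1..N0. if fst p = i then 1 else 0)"
    unfolding S_def by (intro sum_mono leg_ramp_bounds[OF p m])
  also have "\<dots> \<le> 1"
    by simp
  finally have S: "0 \<le> S" "S \<le> 1"
    using leg_ramp_bounds(1)[OF p m] by (auto simp: S_def intro: sum_nonneg)
  have "\<beta> * S \<le> \<bar>\<beta>\<bar> * 1"
    using S by (intro mult_mono) auto
  then show "potential m p \<le> l + \<bar>\<beta>\<bar>"
    by (simp add: potential_def S_def)
  have "- l \<le> \<beta> * S"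
  proof (cases "0 \<le> \<beta>")
    case True
    then have "0 \<le> \<beta> * S" using S by simp
    then show ?thesis using l_pos by linarith
  next
    case False
    then have "\<beta> * 1 \<le> \<beta> * S" using S by (intro mult_left_mono_neg) auto
    then show ?thesis using sum_pos by linarith
  qed
  then show "0 \<le> potential m p"
    by (simp add: potential_def S_def)
qed

definition discount :: "real \<Rightarrow> 'a \<Rightarrow> real" where
  "discount t \<omega> = exp (- (l * t + \<beta> * occ_time N0 b t \<omega>))"

end

context kirchhoff_spider
begin

text \<open>Along a convergent sequence the times are bounded by some \<open>R\<close>. The
  occupation times then stay in \<open>{0..R}\<close>, where \<open>g\<close> is bounded, and
  dominated convergence applies.\<close>

lemma expectation_occ_time_continuous:
  fixes g :: "real \<Rightarrow> real"
  assumes g: "continuous_on UNIV g"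
  shows "continuous_on {0..} (\<lambda>s. expectation (\<lambda>\<omega>. g (occ_time N0 b s \<omega>)))"
  unfolding continuous_on_sequentially comp_def
proof (intro allI ballI impI, elim conjE)
  fix X :: "nat \<Rightarrow> real" and s assume X: "\<forall>n. X n \<in> {0..}" "X \<longlonglongrightarrow> s" and s: "s \<in> {0..}"
  obtain R where R: "\<And>n. \<bar>X n\<bar> \<le> R"
    using convergent_imp_Bseq[OF convergentI[OF X(2)]] unfolding Bseq_def by auto
  have "compact (g ` {0..R})"
    by (intro compact_continuous_image continuous_on_subset[OF g]) auto
  then obtain B where B: "\<And>y. y \<in> {0..R} \<Longrightarrow> \<bar>g y\<bar> \<le> B"
    by (metis bounded_iff compact_imp_bounded imageI real_norm_def)
  have [measurable]: "g \<in> borel_measurable borel"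
    using g by (rule borel_measurable_continuous_onI)
  show "(\<lambda>n. expectation (\<lambda>\<omega>. g (occ_time N0 b (X n) \<omega>))) \<longlonglongrightarrow> expectation (\<lambda>\<omega>. g (occ_time N0 b s \<omega>))"
  proof (rule integral_dominated_convergence[where w = "\<lambda>_. B"])
    show "(\<lambda>\<omega>. g (occ_time N0 b s \<omega>)) \<in> borel_measurable M"
      using occ_time_measurable[of s N0] s by simp
    show "(\<lambda>\<omega>. g (occ_time N0 b (X n) \<omega>)) \<in> borel_measurable M" for n
      using occ_time_measurable[of "X n" N0] X by simp
    show "AE \<omega> in M. (\<lambda>n. g (occ_time N0 b (X n) \<omega>)) \<longlonglongrightarrow> g (occ_time N0 b s \<omega>)"
    proof (rule AE_I2)
      fix \<omega> assume "\<omega> \<in> space M"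
      then have "(\<lambda>n. occ_time N0 b (X n) \<omega>) \<longlonglongrightarrow> occ_time N0 b s \<omega>"
        using X s by (intro continuous_on_tendsto_compose[OF occ_time_continuous]) auto
      then show "(\<lambda>n. g (occ_time N0 b (X n) \<omega>)) \<longlonglongrightarrow> g (occ_time N0 b s \<omega>)"
        by (intro continuous_on_tendsto_compose[OF g]) auto
    qed
    show "AE \<omega> in M. norm (g (occ_time N0 b (X n) \<omega>)) \<le> B" for n
    proof (rule AE_I2)
      fix \<omega> assume "\<omega> \<in> space M"
      then have "occ_time N0 b (X n) \<omega> \<in> {0..R}"
        using occ_time_bounds[of \<omega> "X n" N0] X R[of n] by auto
      then show "norm (g (occ_time N0 b (X n) \<omega>)) \<le> B"
        using B by simp
    qed
  qed simp
qed

end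

context kirchhoff_occupation
begin

lemma time_integral_potential:
  assumes \<omega>: "\<omega> \<in> space M" and r: "0 \<le> r"
  shows "time_integral (potential m) r \<omega> = l * r + \<beta> * (\<Sum>i=1..N0. time_integral (leg_ramp m i) r \<omega>)"
proof -
  have int: "(\<lambda>s. leg_ramp m i (b s \<omega>)) integrable_on {0..r}" if "i \<in> {1..N0}" for i
    using that by (intro integrable_continuous_real spider_continuous_path_upto
        spider_continuous_leg_ramp \<omega>) auto
  have "time_integral (potential m) r \<omega>
      = integral {0..r} (\<lambda>s. l) + integral {0..r} (\<lambda>s. \<beta> * (\<Sum>i=1..N0. leg_ramp m i (b s \<omega>)))"
    unfolding time_integral_def potential_def
    by (intro integral_add integrable_on_mult_right integrable_sum int) auto
  also have "integral {0..r} (\<lambda>s. \<beta> * (\<Sum>i=1..N0. leg_ramp m i (b s \<omega>)))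
      = \<beta> * (\<Sum>i=1..N0. integral {0..r} (\<lambda>s. leg_ramp m i (b s \<omega>)))"
    by (subst integral_mult_right, subst integral_sum) (auto intro: int)
  finally show ?thesis
    using r by (simp add: time_integral_def)
qed

lemma discount_tendsto:
  assumes "\<omega> \<in> space M" "0 \<le> r"
  shows "(\<lambda>n. exp (- time_integral (potential (real (Suc n))) r \<omega>)) \<longlonglongrightarrow> discount r \<omega>"
  unfolding discount_def time_integral_potential[OF assms]
  by (intro tendsto_intros occ_time_tendsto assms)

lemma discount_measurable: "0 \<le> r \<Longrightarrow> discount r \<in> borel_measurable M"
  using occ_time_measurable[of r N0] by (simp add: discount_def[abs_def])

lemma discount_continuous: "\<omega> \<in> space M \<Longrightarrow> continuous_on {0..t} (\<lambda>r. discount r \<omega>)"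
  unfolding discount_def
  by (intro continuous_intros continuous_on_subset[OF occ_time_continuous]) auto

text \<open>Feynman-Kac for the functions \<open>test m\<close> with the potentials
  \<open>potential m\<close>, followed by the limit in \<open>m\<close> on both sides.\<close>

lemma resolvent_identity:
  assumes t: "0 \<le> t"
  shows "u0 = expectation (\<lambda>\<omega>. discount t \<omega> * sol (b t \<omega>))
    + expectation (\<lambda>\<omega>. integral {0..t} (\<lambda>r. discount r \<omega>))"
proof -
  define m where "m = (\<lambda>n. real (Suc n))"
  have m1: "1 \<le> m n" for n
    by (simp add: m_def)
  have m0: "0 < m n" "0 \<le> m n" for n
    using m1[of n] by linarith+
  define gen where "gen = (\<lambda>n. spider_gen (\<lambda>i. leg_test'' u0 l (rate i) (m n)))"
  obtain B0 where B0: "\<And>m p. 1 \<le> m \<Longrightarrow> p \<in> spider_pts N \<Longrightarrow> \<bar>test m p\<bar> \<le> B0"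
    "\<And>m p. 1 \<le> m \<Longrightarrow> p \<in> spider_pts N \<Longrightarrow> \<bar>spider_gen (\<lambda>i. leg_test'' u0 l (rate i) m) p\<bar> \<le> B0"
    using test_bounds by metis
  define B where "B = max B0 (l + \<bar>\<beta>\<bar>)"
  have B: "\<bar>test (m n) p\<bar> \<le> B" "\<bar>gen n p\<bar> \<le> B" "\<bar>potential (m n) p\<bar> \<le> B"
    if "p \<in> spider_pts N" for n p
    using B0(1)[OF m1 that, of n] B0(2)[OF m1 that, of n] potential_bounds[OF that m0(2), of n]
    by (auto simp: B_def gen_def)
  have Bpos: "0 \<le> B"
    using l_pos by (simp add: B_def)
  have tcont: "spider_continuous N (test (m n))" and gcont: "spider_continuous N (gen n)" for n
    using test_dom[OF m0(1), of n] unfolding gen_def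
    by (auto intro: spider_continuous_kirchhoff_dom spider_continuous_spider_gen)
  define Z where "Z = (\<lambda>n r \<omega>. exp (- time_integral (potential (m n)) r \<omega>))"
  have Zb: "0 \<le> Z n r \<omega>" "Z n r \<omega> \<le> 1" if "\<omega> \<in> space M" "0 \<le> r" for n r \<omega>
  proof -
    have "0 \<le> time_integral (potential (m n)) r \<omega>"
      unfolding time_integral_def
      using that potential_bounds(1)[OF b_pts m0(2)]
      by (intro integral_nonneg integrable_continuous_real spider_continuous_path_upto
          potential_continuous) auto
    then show "0 \<le> Z n r \<omega>" "Z n r \<omega> \<le> 1"
      by (auto simp: Z_def)
  qed
  have Zlim: "(\<lambda>n. Z n r \<omega>) \<longlonglongrightarrow> discount r \<omega>" if "\<omega> \<in> space M" "0 \<le> r" for r \<omega>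
    unfolding Z_def m_def by (rule discount_tendsto[OF that])
  have Zm: "Z n r \<in> borel_measurable M" if "0 \<le> r" for n r
    using Filt_measurable[OF time_integral_measurable_Filt[OF that potential_continuous]]
        by (simp add: Z_def)
  have Fm: "(\<lambda>\<omega>. F (b r \<omega>)) \<in> borel_measurable M" if "0 \<le> r" "spider_continuous N F" for r F
    using that by (intro spider_continuous_measurable b_measurable) auto
  define W where "W = (\<lambda>n r \<omega>. Z n r \<omega> * (gen n (b r \<omega>) - potential (m n) (b r \<omega>)
      * test (m n) (b r \<omega>)))"
  have Wm: "W n r \<in> borel_measurable M" if "0 \<le> r" for n r
    using Zm[OF that, of n] Fm[OF that gcont, of n] Fm[OF that potential_continuous, of "m n"]
        Fm[OF that tcont, of n]
    unfolding W_def by simp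
  have Wcont: "continuous_on {0..t} (\<lambda>r. W n r \<omega>)" if \<omega>: "\<omega> \<in> space M" for n \<omega>
  proof -
    note [continuous_intros] = time_integral_continuous[OF \<omega> potential_continuous]
      spider_continuous_path_upto[OF \<omega> potential_continuous]
      spider_continuous_path_upto[OF \<omega> gcont] spider_continuous_path_upto[OF \<omega> tcont]
    show ?thesis
      unfolding W_def Z_def by (intro continuous_intros)
  qed
  have Wb: "\<bar>W n r \<omega>\<bar> \<le> B + B * B" if "\<omega> \<in> space M" "0 \<le> r" for n r \<omega>
  proof -
    note p = b_pts[OF that]
    have "\<bar>potential (m n) (b r \<omega>) * test (m n) (b r \<omega>)\<bar> \<le> B * B"
      unfolding abs_mult by (intro mult_mono B p Bpos) auto
    then have "\<bar>gen n (b r \<omega>) - potential (m n) (b r \<omega>) * test (m n) (b r \<omega>)\<bar> \<le> B + B * B"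
      using B(2)[OF p, of n] by linarith
    then have "\<bar>W n r \<omega>\<bar> \<le> 1 * (B + B * B)"
      unfolding W_def abs_mult using Zb[OF that, of n] by (intro mult_mono) auto
    then show ?thesis by simp
  qed
  have Wlim: "(\<lambda>n. W n r \<omega>) \<longlonglongrightarrow> - discount r \<omega>" if "\<omega> \<in> space M" "0 \<le> r" for r \<omega>
  proof -
    note p = b_pts[OF that]
    \<comment> \<open>In the limit the generator gives \<open>rate * sol - 1\<close> and the
      potential term gives \<open>rate * sol\<close>. Only -1 remains, at the origin too.\<close>
    have "(\<lambda>n. W n r \<omega>) \<longlonglongrightarrow> discount r \<omega> * ((rate (fst (b r \<omega>)) * sol (b r \<omega>) - 1)
        - rate (fst (b r \<omega>)) * sol (b r \<omega>))"
      unfolding W_def gen_def using test_tendsto[OF p] test_gen_tendsto[OF p] potential_tendsto[OF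
          p] Zlim[OF that]
      by (intro tendsto_mult tendsto_diff) (simp_all add: m_def)
    then show ?thesis by simp
  qed
  have FK: "expectation (\<lambda>\<omega>. Z n t \<omega> * test (m n) (b t \<omega>)) - u0
      = expectation (\<lambda>\<omega>. integral {0..t} (\<lambda>r. W n r \<omega>))" for n
    using feynman_kac[OF test_dom[OF m0(1)] potential_continuous t B(3) B(1) B(2)[unfolded gen_def]]
    unfolding Z_def W_def gen_def by (simp add: test_origin[OF m0(1)])
  have L: "(\<lambda>n. expectation (\<lambda>\<omega>. Z n t \<omega> * test (m n) (b t \<omega>)))
      \<longlonglongrightarrow> expectation (\<lambda>\<omega>. discount t \<omega> * sol (b t \<omega>))"
  proof (rule integral_dominated_convergence[where w = "\<lambda>_. B"])
    show m: "(\<lambda>\<omega>. Z n t \<omega> * test (m n) (b t \<omega>)) \<in> borel_measurable M" for n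
      using Zm[OF t] Fm[OF t tcont] by simp
    have lim: "(\<lambda>n. Z n t \<omega> * test (m n) (b t \<omega>))
        \<longlonglongrightarrow> discount t \<omega> * sol (b t \<omega>)" if "\<omega> \<in> space M" for \<omega>
      using Zlim[OF that t] test_tendsto[OF b_pts[OF that t]] unfolding m_def by (rule tendsto_mult)
    then show "AE \<omega> in M. (\<lambda>n. Z n t \<omega> * test (m n) (b t \<omega>)) \<longlonglongrightarrow> discount t \<omega> * sol (b t \<omega>)"
      by (rule AE_I2)
    show "(\<lambda>\<omega>. discount t \<omega> * sol (b t \<omega>)) \<in> borel_measurable M"
      by (rule borel_measurable_LIMSEQ_real[OF lim m])
    have "\<bar>Z n t \<omega>\<bar> * \<bar>test (m n) (b t \<omega>)\<bar> \<le> 1 * B" if "\<omega> \<in> space M" for n \<omega>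
      using Zb[OF that t, of n] by (intro mult_mono B b_pts that t) auto
    then show "AE \<omega> in M. norm (Z n t \<omega> * test (m n) (b t \<omega>)) \<le> B" for n
      by (intro AE_I2) (simp add: abs_mult)
  qed simp
  have R: "(\<lambda>n. expectation (\<lambda>\<omega>. integral {0..t} (\<lambda>r. W n r \<omega>)))
      \<longlonglongrightarrow> expectation (\<lambda>\<omega>. integral {0..t} (\<lambda>r. - discount r \<omega>))"
  proof (rule integral_dominated_convergence[where w = "\<lambda>_. (B + B * B) * t"])
    show "(\<lambda>\<omega>. integral {0..t} (\<lambda>r. W n r \<omega>)) \<in> borel_measurable M" for n
      by (intro borel_measurable_time_integral t Wm Wcont) auto
    show "(\<lambda>\<omega>. integral {0..t} (\<lambda>r. - discount r \<omega>)) \<in> borel_measurable M"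
      using discount_measurable
      by (intro borel_measurable_time_integral t continuous_intros discount_continuous) auto
    show "AE \<omega> in M. norm (integral {0..t} (\<lambda>r. W n r \<omega>)) \<le> (B + B * B) * t" for n
      unfolding real_norm_def using Wb by (intro AE_I2 integral_abs_bound[OF Wcont _ t]) auto
    show "AE \<omega> in M. (\<lambda>n. integral {0..t} (\<lambda>r. W n r \<omega>)) \<longlonglongrightarrow> integral {0..t} (\<lambda>r. - discount r \<omega>)"
    proof (rule AE_I2)
      fix \<omega> assume \<omega>: "\<omega> \<in> space M"
      show "(\<lambda>n. integral {0..t} (\<lambda>r. W n r \<omega>)) \<longlonglongrightarrow> integral {0..t} (\<lambda>r. - discount r \<omega>)"
      proof (rule dominated_convergence(2)[where h = "\<lambda>_. B + B * B"])
        show "(\<lambda>r. W n r \<omega>) integrable_on {0..t}" for n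
          by (intro integrable_continuous_real Wcont \<omega>)
      qed (use Wb Wlim \<omega> in auto)
    qed
  qed simp
  have "(\<lambda>n. expectation (\<lambda>\<omega>. Z n t \<omega> * test (m n) (b t \<omega>)) - u0)
      \<longlonglongrightarrow> expectation (\<lambda>\<omega>. discount t \<omega> * sol (b t \<omega>)) - u0"
    by (intro tendsto_intros L)
  from LIMSEQ_unique[OF this[unfolded FK] R] show ?thesis
    by simp
qed

end

subsection \<open>Moments of the occupation time\<close>

context kirchhoff_occupation
begin

text \<open>The occupation time lies between 0 and \<open>r\<close>, so the exponent is at least its
  value at the worse of these two extremes.\<close>

lemma discount_bound:
  assumes "\<omega> \<in> space M" "0 \<le> r"
  shows "\<bar>discount r \<omega>\<bar> \<le> exp (- min l (l + \<beta>) * r)"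
proof -
  define q where "q = occ_time N0 b r \<omega>"
  have q: "0 \<le> q" "q \<le> r"
    using occ_time_bounds[OF assms, of N0] by (auto simp: q_def)
  have "min 0 \<beta> * r \<le> min 0 \<beta> * q"
    using q by (intro mult_left_mono_neg) auto
  also have "\<dots> \<le> \<beta> * q"
    using q by (intro mult_right_mono) auto
  finally have "min l (l + \<beta>) * r \<le> l * r + \<beta> * q"
    by (simp add: min_def algebra_simps split: if_splits)
  then show ?thesis
    by (simp add: discount_def q_def)
qed

text \<open>Let \<open>t\<close> tend to infinity in \<open>resolvent_identity\<close>:
  \<open>sol\<close> is bounded and the discount decays exponentially, so the boundary term
  disappears.\<close>

lemma laplace_occ_time:
  "set_integrable lborel {0..} (\<lambda>s. exp (- l * s) * expectation (\<lambda>\<omega>. exp (- \<beta>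
      * occ_time N0 b s \<omega>)))"
  "(LINT s:{0..}|lborel. exp (- l * s) * expectation (\<lambda>\<omega>. exp (- \<beta> * occ_time N0 b s \<omega>))) = u0"
proof -
  define c where "c = min l (l + \<beta>)"
  have c: "0 < c"
    using l_pos sum_pos by (simp add: c_def)
  define \<zeta> where "\<zeta> = (\<lambda>s. exp (- l * s) * expectation (\<lambda>\<omega>. exp (- \<beta> * occ_time N0 b s \<omega>)))"
  have \<zeta>_eq: "\<zeta> s = expectation (discount s)" for s
    by (simp add: \<zeta>_def discount_def[abs_def] exp_diff exp_minus field_simps flip:
        integral_mult_right_zero)
  have "continuous_on UNIV (\<lambda>x::real. exp (- \<beta> * x))"
    by (intro continuous_intros)
  from expectation_occ_time_continuous[OF this, of N0]
  have cont: "continuous_on {0..} \<zeta>"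
    unfolding \<zeta>_def by (intro continuous_intros)
  have bound: "\<bar>\<zeta> s\<bar> \<le> 1 * exp (- c * s)" if "0 \<le> s" for s
    using expectation_abs_bound[OF discount_bound[OF _ that]] by (simp add: \<zeta>_eq c_def)
  show int: "set_integrable lborel {0..} \<zeta>"
    by (rule set_integrable_exp_decay[OF cont c bound])
  obtain B where B: "\<And>p. p \<in> spider_pts N \<Longrightarrow> \<bar>sol p\<bar> \<le> B"
  proof -
    obtain A1 where A1: "\<And>x. 0 \<le> x \<Longrightarrow> \<bar>leg_sol u0 (l + \<beta>) x\<bar> \<le> A1"
      using leg_sol_bounds[OF sum_pos] by metis
    obtain A2 where A2: "\<And>x. 0 \<le> x \<Longrightarrow> \<bar>leg_sol u0 l x\<bar> \<le> A2"
      using leg_sol_bounds[OF l_pos] by metis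
    have "\<bar>sol p\<bar> \<le> max A1 A2" if "p \<in> spider_pts N" for p
    proof -
      have "0 \<le> snd p"
        using that by (auto simp: spider_pts_def spider_origin_def)
      then show ?thesis
        using A1[of "snd p"] A2[of "snd p"] by (auto simp: sol_def rate_def)
    qed
    then show thesis
      by (rule that)
  qed
  have res: "\<bar>u0 - (LINT s:{0..t}|lborel. \<zeta> s)\<bar> \<le> B * exp (- c * t)" if t: "0 \<le> t" for t
  proof -
    have "expectation (\<lambda>\<omega>. integral {0..t} (\<lambda>r. discount r \<omega>))
        = (LINT s:{0..t}|lborel. expectation (discount s))"
    proof (rule expectation_time_integral[OF t])
      fix r \<omega> assume "r \<in> {0..t}" "\<omega> \<in> space M"
      then show "\<bar>discount r \<omega>\<bar> \<le> 1"
        using discount_bound[of \<omega> r] c by (force simp: c_def intro: order_trans)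
    qed (auto intro: discount_measurable discount_continuous)
    then have "u0 - (LINT s:{0..t}|lborel. \<zeta> s) = expectation (\<lambda>\<omega>. discount t \<omega> * sol (b t \<omega>))"
      using resolvent_identity[OF t] by (simp add: \<zeta>_eq)
    moreover have "\<bar>discount t \<omega> * sol (b t \<omega>)\<bar> \<le> exp (- c * t) * B" if "\<omega> \<in> space M" for \<omega>
      unfolding abs_mult
      using discount_bound[OF that t] by (intro mult_mono B b_pts that t) (auto simp: c_def)
    ultimately show ?thesis
      using expectation_abs_bound[of "\<lambda>\<omega>. discount t \<omega> * sol (b t \<omega>)"] by (simp add: mult.commute)
  qed
  have "((\<lambda>t. B * exp (- c * t)) \<longlongrightarrow> 0) at_top"
    using c by real_asymp
  then have "((\<lambda>t. u0 - (LINT s:{0..t}|lborel. \<zeta> s)) \<longlongrightarrow> 0) at_top"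
    by (rule Lim_null_comparison[rotated], intro eventually_at_top_linorderI[of 0]) (use res in
        simp)
  then have "((\<lambda>t. u0 - (u0 - (LINT s:{0..t}|lborel. \<zeta> s))) \<longlongrightarrow> u0 - 0) at_top"
    by (intro tendsto_intros)
  then have L1: "((\<lambda>t. LINT s:{0..t}|lborel. \<zeta> s) \<longlongrightarrow> u0) at_top"
    by simp
  have "((\<lambda>t. LINT s|lborel. indicator {..t} s *\<^sub>R (indicator {0..} s *\<^sub>R \<zeta> s)) \<longlongrightarrow> (LINT
      s:{0..}|lborel. \<zeta> s)) at_top"
    using tendsto_integral_at_top[OF _ int[unfolded set_integrable_def]]
    by (simp add: set_lebesgue_integral_def)
  moreover have "(LINT s|lborel. indicator {..t} s *\<^sub>R (indicator {0..} s *\<^sub>R \<zeta> s))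
      = (LINT s:{0..t}|lborel. \<zeta> s)" for t
    unfolding set_lebesgue_integral_def
    by (intro Bochner_Integration.integral_cong) (auto simp: indicator_def)
  ultimately have "((\<lambda>t. LINT s:{0..t}|lborel. \<zeta> s) \<longlongrightarrow> (LINT s:{0..}|lborel. \<zeta> s)) at_top"
    by simp
  from tendsto_unique[OF _ this L1] show "(LINT s:{0..}|lborel. \<zeta> s) = u0"
    by simp
qed

end

section \<open>Moments and their Laplace transforms\<close>

context kirchhoff_spider
begin

definition occ_moment :: "nat \<Rightarrow> nat \<Rightarrow> real \<Rightarrow> real" where
  "occ_moment N0 n s = expectation (\<lambda>\<omega>. occ_time N0 b s \<omega> ^ n)"

lemma occ_time_power_bound:
  assumes "\<omega> \<in> space M" "0 \<le> s"
  shows "\<bar>occ_time N0 b s \<omega> ^ n\<bar> \<le> s ^ n"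
  using occ_time_bounds[OF assms, of N0] by (simp add: power_mono)

lemma occ_time_power_integrable: "0 \<le> s \<Longrightarrow> integrable M (\<lambda>\<omega>. occ_time N0 b s \<omega> ^ n)"
  by (rule integrable_const_bound[of _ "s ^ n"])
    (auto intro!: AE_I2 occ_time_power_bound borel_measurable_power occ_time_measurable simp flip:
        power_abs)

lemma occ_moment_bounds:
  assumes "0 \<le> s"
  shows "0 \<le> occ_moment N0 n s" "occ_moment N0 n s \<le> s ^ n"
proof -
  show "0 \<le> occ_moment N0 n s"
    unfolding occ_moment_def using occ_time_bounds(1)[OF _ assms]
    by (intro integral_nonneg_AE AE_I2) auto
  have "occ_moment N0 n s \<le> expectation (\<lambda>_. s ^ n)"
    unfolding occ_moment_def
    using occ_time_power_bound[OF _ assms]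
        by (intro integral_mono occ_time_power_integrable assms) (auto simp: abs_le_iff)
  then show "occ_moment N0 n s \<le> s ^ n"
    by (simp add: prob_space)
qed

lemma occ_moment_continuous: "continuous_on {0..} (occ_moment N0 n)"
  unfolding occ_moment_def[abs_def]
  by (intro expectation_occ_time_continuous continuous_intros)

text \<open>Since the occupation time is at most \<open>s\<close>, the exponential series is
  dominated by that of \<open>\<bar>\<beta>\<bar> * s\<close> and may be integrated term by
  term.\<close>

lemma expectation_exp_occ_time_sums:
  assumes s: "0 \<le> s"
  shows "(\<lambda>n. (- \<beta>) ^ n / fact n * occ_moment N0 n s)
      sums expectation (\<lambda>\<omega>. exp (- \<beta> * occ_time N0 b s \<omega>))"
proof -
  define f where "f = (\<lambda>n \<omega>. (- \<beta>) ^ n / fact n * occ_time N0 b s \<omega> ^ n)"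
  have f: "f n \<omega> = (- \<beta> * occ_time N0 b s \<omega>) ^ n /\<^sub>R fact n" for n \<omega>
    by (simp add: f_def power_mult_distrib[symmetric] field_simps)
  have intf: "integrable M (f n)" for n
    unfolding f_def by (intro integrable_mult_right occ_time_power_integrable s)
  have "(\<lambda>n. expectation (f n)) sums expectation (\<lambda>\<omega>. \<Sum>n. f n \<omega>)"
  proof (rule sums_integral[OF intf])
    show "AE \<omega> in M. summable (\<lambda>n. norm (f n \<omega>))"
      unfolding f by (intro AE_I2 summable_norm_exp)
    show "summable (\<lambda>n. expectation (\<lambda>\<omega>. norm (f n \<omega>)))"
    proof (rule summable_comparison_test'[of "\<lambda>n. (\<bar>\<beta>\<bar> * s) ^ n /\<^sub>R fact n" 0])
      show "summable (\<lambda>n. (\<bar>\<beta>\<bar> * s) ^ n /\<^sub>R fact n)"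
        by (rule sums_summable[OF exp_converges])
      fix n
      have "norm (f n \<omega>) \<le> (\<bar>\<beta>\<bar> * s) ^ n /\<^sub>R fact n" if "\<omega> \<in> space M" for \<omega>
      proof -
        have "norm (f n \<omega>) = \<bar>\<beta>\<bar> ^ n / fact n * \<bar>occ_time N0 b s \<omega> ^ n\<bar>"
          by (simp add: f_def abs_mult power_abs)
        also have "\<dots> \<le> \<bar>\<beta>\<bar> ^ n / fact n * s ^ n"
          by (intro mult_left_mono occ_time_power_bound that s) auto
        finally show ?thesis
          by (simp add: power_mult_distrib field_simps)
      qed
      then have "expectation (\<lambda>\<omega>. norm (f n \<omega>)) \<le> expectation (\<lambda>\<omega>. (\<bar>\<beta>\<bar> * s) ^ n /\<^sub>R fact n)"
        by (intro integral_mono integrable_norm intf) auto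
      then show "norm (expectation (\<lambda>\<omega>. norm (f n \<omega>))) \<le> (\<bar>\<beta>\<bar> * s) ^ n /\<^sub>R fact n"
        by (simp add: prob_space)
    qed
  qed
  moreover have "(\<Sum>n. f n \<omega>) = exp (- \<beta> * occ_time N0 b s \<omega>)" for \<omega>
    unfolding f by (rule sums_unique[OF exp_converges, symmetric])
  moreover have "expectation (f n) = (- \<beta>) ^ n / fact n * occ_moment N0 n s" for n
    by (simp add: f_def occ_moment_def)
  ultimately show ?thesis
    by simp
qed

lemma laplace_occ_moment_integrable:
  assumes "0 < l"
  shows "set_integrable lborel {0..} (\<lambda>s. exp (- l * s) * occ_moment N0 n s)"
proof (rule set_integrable_bound[OF laplace_power(1)[OF assms, of n]])
  have "continuous_on {0..} (\<lambda>s. exp (- l * s) * occ_moment N0 n s)"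
    by (intro continuous_intros occ_moment_continuous)
  from borel_measurable_continuous_on_indicator[OF _ this]
  show "set_borel_measurable lborel {0..} (\<lambda>s. exp (- l * s) * occ_moment N0 n s)"
    by (simp add: set_borel_measurable_def)
  show "AE s in lborel. s \<in> {0..} \<longrightarrow> norm (exp (- l * s) * occ_moment N0 n s)
      \<le> norm (exp (- l * s) * s ^ n)"
    using occ_moment_bounds by (intro AE_I2) (auto simp: abs_mult)
qed

text \<open>With \<open>\<beta> = l * x\<close>, the integral of the absolute value of the
  \<open>n\<close>-th term is at most \<open>\<bar>x\<bar> ^ n / l\<close>. The geometric series
  justifies exchanging sum and integral, and the total is \<open>u0\<close>.\<close>

lemma laplace_occ_moment_sums:
  assumes N0: "N0 \<le> N" and l: "0 < l" and x: "\<bar>x\<bar> < 1"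
  shows "(\<lambda>n. (- l) ^ n / fact n * (LINT s:{0..}|lborel. exp (- l * s) * occ_moment N0 n s) * x ^ n)
    sums (1 / l * ((real N0 / sqrt (1 + x) + real (N - N0)) / (real N0 * sqrt (1 + x)
        + real (N - N0))))"
proof -
  have "\<bar>l * x\<bar> < l"
    using mult_strict_left_mono[OF x l] l by (simp add: abs_mult)
  \<comment> \<open>Here \<open>l * x\<close> may have either sign; the bound on \<open>x\<close>
    keeps \<open>l + l * x\<close> positive, as the locale demands.\<close>
  then interpret kirchhoff_occupation N M b N0 l "l * x"
    by unfold_locales (use N0 l in auto)
  define f where "f = (\<lambda>n s. indicator {0..} s *\<^sub>R ((- (l * x)) ^ n / fact n * (exp (- l * s)
      * occ_moment N0 n s)))"
  have intf: "integrable lborel (f n)" for n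
    using set_integrable_mult_right[OF laplace_occ_moment_integrable[OF l]]
    unfolding f_def set_integrable_def by blast
  have fs: "(\<lambda>n. f n s) sums (indicator {0..} s *\<^sub>R (exp (- l * s) * expectation (\<lambda>\<omega>. exp (- (l
      * x) * occ_time N0 b s \<omega>))))" for s
  proof (cases "0 \<le> s")
    case True
    from sums_mult[OF expectation_exp_occ_time_sums[OF True], of "exp (- l * s)" "l * x" N0]
    show ?thesis
      using True by (simp add: f_def mult_ac)
  qed (simp add: f_def)
  have nf: "norm (f n s) \<le> \<bar>l * x\<bar> ^ n / fact n * (indicator {0..} s *\<^sub>R (exp (- l * s)
      * s ^ n))" for n s
  proof (cases "0 \<le> s")
    case True
    then have "\<bar>occ_moment N0 n s\<bar> \<le> s ^ n"
      using occ_moment_bounds[OF True, of N0 n] by simp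
    then have "(\<bar>l * x\<bar> ^ n / fact n * exp (- l * s)) * \<bar>occ_moment N0 n s\<bar>
        \<le> (\<bar>l * x\<bar> ^ n / fact n * exp (- l * s)) * s ^ n"
      by (intro mult_left_mono) auto
    then show ?thesis
      using True by (simp add: f_def abs_mult power_abs mult_ac)
  qed (simp add: f_def)
  have "(\<lambda>n. integral\<^sup>L lborel (f n)) sums (LINT s|lborel. (\<Sum>n. f n s))"
  proof (rule sums_integral[OF intf])
    show "AE s in lborel. summable (\<lambda>n. norm (f n s))"
    proof (rule AE_I2, rule summable_comparison_test')
      fix s :: real
      show "summable (\<lambda>n. (indicator {0..} s * exp (- l * s)) * ((\<bar>l * x\<bar> * s) ^ n /\<^sub>R fact n))"
        by (intro summable_mult sums_summable[OF exp_converges])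
      show "norm (norm (f n s)) \<le> (indicator {0..} s * exp (- l * s)) * ((\<bar>l * x\<bar>
          * s) ^ n /\<^sub>R fact n)" for n
        using nf[of n s] by (simp add: power_mult_distrib field_simps)
    qed
    show "summable (\<lambda>n. LINT s|lborel. norm (f n s))"
    proof (rule summable_comparison_test')
      show "summable (\<lambda>n. 1 / l * \<bar>x\<bar> ^ n)"
        using x by (intro summable_mult summable_geometric) auto
      fix n
      have "(LINT s|lborel. norm (f n s))
          \<le> (LINT s|lborel. \<bar>l * x\<bar> ^ n / fact n * (indicator {0..} s *\<^sub>R (exp (- l * s) * s ^ n)))"
        using laplace_power(1)[OF l, of n]
        by (intro integral_mono integrable_norm intf integrable_mult_right nf) (simp add:
            set_integrable_def)
      also have "\<dots> = \<bar>l * x\<bar> ^ n / fact n * (fact n / l ^ Suc n)"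
        using laplace_power(2)[OF l, of n] by (simp add: set_lebesgue_integral_def)
      also have "\<dots> = 1 / l * \<bar>x\<bar> ^ n"
        using l by (simp add: abs_mult power_mult_distrib field_simps)
      finally show "norm (LINT s|lborel. norm (f n s)) \<le> 1 / l * \<bar>x\<bar> ^ n"
        by simp
    qed
  qed
  also have "(LINT s|lborel. (\<Sum>n. f n s)) = u0"
    using laplace_occ_time(2) unfolding sums_unique[OF fs, symmetric] set_lebesgue_integral_def .
  finally have "(\<lambda>n. integral\<^sup>L lborel (f n)) sums u0" .
  moreover have "integral\<^sup>L lborel (f n)
      = (- l) ^ n / fact n * (LINT s:{0..}|lborel. exp (- l * s) * occ_moment N0 n s) * x ^ n" for n
  proof -
    have "integral\<^sup>L lborel (f n) = (- (l * x)) ^ n / fact n * (LINT s:{0..}|lborel. exp (- l * s)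
        * occ_moment N0 n s)"
      unfolding f_def set_lebesgue_integral_def[symmetric] by (rule set_integral_mult_right)
    moreover have "(- (l * x)) ^ n = (- l) ^ n * x ^ n"
      by (simp flip: power_mult_distrib)
    ultimately show ?thesis
      by simp
  qed
  moreover have "u0 = 1 / l * ((real N0 / sqrt (1 + x) + real (N - N0)) / (real N0 * sqrt (1 + x)
      + real (N - N0)))"
  proof -
    \<comment> \<open>Factoring \<open>sqrt l\<close> out of every root shows that \<open>u0\<close>
      is \<open>1 / l\<close> times a function of \<open>x\<close> alone.\<close>
    have eq: "sqrt (l + l * x) = sqrt l * sqrt (1 + x)"
      by (simp add: distrib_left flip: real_sqrt_mult)
    have "real N0 / (sqrt l * sqrt (1 + x)) + real (N - N0) / sqrt l
        = (real N0 / sqrt (1 + x) + real (N - N0)) / sqrt l"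
      by (simp add: add_divide_distrib mult.commute)
    moreover have "real N0 * (sqrt l * sqrt (1 + x)) + real (N - N0) * sqrt l
        = (real N0 * sqrt (1 + x) + real (N - N0)) * sqrt l"
      by (simp add: algebra_simps)
    ultimately show ?thesis
      using l unfolding u0_def eq by simp
  qed
  ultimately show ?thesis
    by simp
qed

end

subsection \<open>The generating function\<close>

definition spider_gf :: "nat \<Rightarrow> nat \<Rightarrow> complex \<Rightarrow> complex" where
  "spider_gf N N0 z = 1 / csqrt (1 + z) *
     ((of_nat N0 + of_nat (N - N0) * csqrt (1 + z)) / (of_nat (N - N0) + of_nat N0 * csqrt (1
         + z)))"

text \<open>The principal root has nonnegative real part; were it purely imaginary, its square would
  have nonpositive real part.\<close>

lemma Re_csqrt_pos:
  assumes "0 < Re z"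
  shows "0 < Re (csqrt z)"
proof (rule ccontr)
  assume "\<not> 0 < Re (csqrt z)"
  then have "Re (csqrt z) = 0"
    using csqrt_principal[of z] by auto
  then have "Re ((csqrt z)\<^sup>2) \<le> 0"
    by (simp add: power2_eq_square)
  then show False
    using assms by simp
qed

text \<open>On the unit disc \<open>1 + z\<close> stays in the right half-plane, hence so does its
  root. The denominator then has positive real part, because its two nonnegative weights are not
  both 0.\<close>

lemma spider_gf_holomorphic:
  assumes "1 \<le> N"
  shows "spider_gf N N0 holomorphic_on ball 0 1"
proof -
  have pos: "0 < Re (csqrt (1 + z))" if "z \<in> ball 0 1" for z
    using that abs_Re_le_cmod[of z] by (intro Re_csqrt_pos) auto
  have *: "(\<lambda>z. csqrt (1 + z)) holomorphic_on ball 0 1"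
  proof (intro holomorphic_on_csqrt' holomorphic_intros)
    fix z :: complex assume "z \<in> ball 0 1"
    then show "1 + z \<notin> \<real>\<^sub>\<le>\<^sub>0"
      using abs_Re_le_cmod[of z] by (auto simp: complex_nonpos_Reals_iff)
  qed
  have ne: "csqrt (1 + z) \<noteq> 0" "of_nat (N - N0) + of_nat N0 * csqrt (1 + z) \<noteq> 0"
      if "z \<in> ball 0 1" for z
  proof -
    show "csqrt (1 + z) \<noteq> 0"
      using pos[OF that] by force
    have "0 < real (N - N0) + real N0 * Re (csqrt (1 + z))"
    proof (cases "N0 = 0")
      case False
      then show ?thesis
        using pos[OF that] by (intro add_nonneg_pos) auto
    qed (use assms in auto)
    then have "0 < Re (of_nat (N - N0) + of_nat N0 * csqrt (1 + z))"
      by simp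
    then show "of_nat (N - N0) + of_nat N0 * csqrt (1 + z) \<noteq> 0"
      by (metis less_irrefl zero_complex.sel(1))
  qed
  show ?thesis
    unfolding spider_gf_def[abs_def] using ne by (intro holomorphic_intros *) auto
qed

lemma spider_gf_of_real:
  assumes "\<bar>x\<bar> < 1"
  shows "spider_gf N N0 (of_real x)
    = of_real ((real N0 / sqrt (1 + x) + real (N - N0)) / (real N0 * sqrt (1 + x) + real (N - N0)))"
proof -
  have pos: "0 < sqrt (1 + x)"
    using assms by simp
  have "csqrt (1 + of_real x) = of_real (sqrt (1 + x))"
    using assms csqrt_of_real_nonneg[of "1 + of_real x"] by simp
  moreover have "real N0 / sqrt (1 + x) + real (N - N0)
      = (real N0 + real (N - N0) * sqrt (1 + x)) / sqrt (1 + x)"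
    using pos by (simp add: field_simps)
  ultimately show ?thesis
    unfolding spider_gf_def by (simp add: add.commute)
qed

context kirchhoff_spider
begin

text \<open>Comparing coefficients in \<open>x\<close> for each fixed \<open>l\<close> makes the
  transform of the moment proportional to \<open>1 / l ^ Suc n\<close>, which is the transform of a
  multiple of \<open>s ^ n\<close>. Uniqueness finishes the proof.\<close>

lemma occ_moment_eq:
  assumes N0: "N0 \<le> N" and s: "0 \<le> s"
  shows "complex_of_real (occ_moment N0 n s)
      = (-1) ^ n * ((deriv ^^ n) (spider_gf N N0) 0 / fact n) * of_real s ^ n"
proof -
  define a where "a = (\<lambda>n. (deriv ^^ n) (spider_gf N N0) 0 / fact n)"
  define \<phi> where "\<phi> = (\<lambda>x. (real N0 / sqrt (1 + x) + real (N - N0)) / (real N0 * sqrt (1 + x)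
      + real (N - N0)))"
  define J where "J = (\<lambda>l n. LINT s:{0..}|lborel. exp (- l * s) * occ_moment N0 n s)"
  have a: "(\<lambda>n. a n * of_real x ^ n) sums of_real (\<phi> x)" if "\<bar>x\<bar> < 1" for x
    using holomorphic_power_series[OF spider_gf_holomorphic[OF legs], of "of_real x" N0] that
    by (simp add: a_def \<phi>_def spider_gf_of_real)
  have Re_a: "(\<lambda>n. Re (a n) * x ^ n) sums \<phi> x" if "\<bar>x\<bar> < 1" for x
    using sums_Re[OF a[OF that]] by (simp flip: of_real_power)
  \<comment> \<open>The generating function is real on (-1,1), so its complex Taylor coefficients
    are real and the comparison can be made over the reals.\<close>
  have Im_a: "(\<lambda>n. Im (a n) * x ^ n) sums 0" if "\<bar>x\<bar> < 1" for x
    using sums_Im[OF a[OF that]] by (simp flip: of_real_power)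
  have an: "a n = of_real (Re (a n))"
    using powser_real_zero_coeffs[OF Im_a, of n] by (simp add: complex_eq_iff)
  have J: "J l n = (-1) ^ n * Re (a n) * (fact n / l ^ Suc n)" if l: "0 < l" for l
  proof -
    \<comment> \<open>Multiplication by \<open>l\<close> cancels the prefactor \<open>1 / l\<close>,
      so both series have the sum \<open>\<phi> x\<close>.\<close>
    have "(\<lambda>n. (l * ((- l) ^ n / fact n * J l n) - Re (a n)) * x ^ n) sums 0" if x: "\<bar>x\<bar> < 1" for x
      using sums_diff[OF sums_mult[OF laplace_occ_moment_sums[OF N0 l x], of l] Re_a[OF x]] l
      by (simp add: J_def \<phi>_def algebra_simps)
    from powser_real_zero_coeffs[OF this, of n]
    have "l * ((- l) ^ n / fact n * J l n) = Re (a n)"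
      by simp
    moreover have "(- l) ^ n = (-1) ^ n * l ^ n"
      by (rule power_minus)
    ultimately have "Re (a n) = (-1) ^ n * (l ^ Suc n / fact n * J l n)"
      by (simp add: algebra_simps)
    then show ?thesis
      using l by simp
  qed
  define D where "D = (\<lambda>s. occ_moment N0 n s - (-1) ^ n * Re (a n) * s ^ n)"
  have "D s = 0"
  proof (rule laplace_unique[OF _ _ _ s])
    show "continuous_on {0..} D"
      unfolding D_def by (intro continuous_intros occ_moment_continuous)
    show "\<bar>D s\<bar> \<le> (1 + \<bar>Re (a n)\<bar>) * (fact n * 2 ^ n) * exp (s / 2)" if "0 \<le> s" for s
    proof -
      have "\<bar>D s\<bar> \<le> s ^ n + \<bar>(-1) ^ n * Re (a n) * s ^ n\<bar>"
        using occ_moment_bounds[OF that, of N0 n] unfolding D_def by linarith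
      also have "\<dots> = (1 + \<bar>Re (a n)\<bar>) * s ^ n"
        using that by (simp add: abs_mult algebra_simps)
      also have "\<dots> \<le> (1 + \<bar>Re (a n)\<bar>) * (fact n * 2 ^ n * exp (s / 2))"
        using power_le_exp_half[OF that, of n] by (intro mult_left_mono) auto
      finally show ?thesis
        by (simp add: mult.assoc)
    qed
    fix k :: nat assume "1 \<le> k"
    then have k: "0 < real k"
      by simp
    have "(LINT s:{0..}|lborel. exp (- real k * s) * D s)
      = (LINT s:{0..}|lborel. exp (- real k * s) * occ_moment N0 n s - (-1) ^ n * Re (a n)
          * (exp (- real k * s) * s ^ n))"
      by (simp add: D_def algebra_simps)
    also have "\<dots> = J (real k) n - (-1) ^ n * Re (a n) * (fact n / real k ^ Suc n)"
      unfolding J_def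
      by (subst set_integral_diff(2)[OF laplace_occ_moment_integrable[OF k]
          set_integrable_mult_right[OF laplace_power(1)[OF k]]])
        (simp only: set_integral_mult_right laplace_power(2)[OF k])
    finally show "(LINT s:{0..}|lborel. exp (- real k * s) * D s) = 0"
      by (simp add: J[OF k])
  qed
  then have "complex_of_real (occ_moment N0 n s) = (-1) ^ n * of_real (Re (a n)) * of_real s ^ n"
    by (simp add: D_def)
  then show ?thesis
    using an by (simp add: a_def)
qed

end

theorem theorem2p11:
  fixes N N0 :: nat and M :: "'w measure" and b :: "real \<Rightarrow> 'w \<Rightarrow> nat \<times> real"
    and t :: real and z :: complex
  assumes "1 \<le> N0" and "N0 \<le> N"
    and "spider_BM N M b"
    and "\<forall>\<omega>\<in>space M. b 0 \<omega> = spider_origin"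
    and "t > 0"
    and "cmod z < 1"
  shows "(\<lambda>n. (-1) ^ n * complex_of_real (\<integral>\<omega>. (occ_time N0 b t \<omega> / t) ^ n \<partial>M) * z ^ n)
           sums (1 / csqrt (1 + z) *
                 ((of_nat N0 + of_nat (N - N0) * csqrt (1 + z)) /
                  (of_nat (N - N0) + of_nat N0 * csqrt (1 + z))))"
proof -
  interpret kirchhoff_spider N M b
    by unfold_locales (use assms in auto)
  \<comment> \<open>The sign of the alternating series cancels the one in
    \<open>occ_moment_eq\<close>, which leaves the Taylor coefficients of
    \<open>spider_gf\<close>.\<close>
  have "(-1) ^ n * complex_of_real (\<integral>\<omega>. (occ_time N0 b t \<omega> / t) ^ n \<partial>M)
      = (deriv ^^ n) (spider_gf N N0) 0 / fact n" for n
  proof -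
    have "(\<integral>\<omega>. (occ_time N0 b t \<omega> / t) ^ n \<partial>M) = occ_moment N0 n t / t ^ n"
      by (simp add: occ_moment_def power_divide)
    then have "(-1) ^ n * complex_of_real (\<integral>\<omega>. (occ_time N0 b t \<omega> / t) ^ n \<partial>M)
        = ((-1) ^ n * (-1) ^ n) * ((deriv ^^ n) (spider_gf N N0) 0 / fact n)"
      using occ_moment_eq[OF assms(2), of t n] assms(5) by simp
    then show ?thesis
      by (simp flip: power_mult_distrib)
  qed
  moreover have "(\<lambda>n. (deriv ^^ n) (spider_gf N N0) 0 / fact n * (z - 0) ^ n) sums spider_gf N N0 z"
    by (rule holomorphic_power_series[OF spider_gf_holomorphic[OF legs]]) (use assms(6) in simp)
  ultimately show ?thesis
    by (simp add: spider_gf_def)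
qed

end
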